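(* Let $E=L_p(\Omega,\mu)$ be the complex $L_p$ space of a measure space $(\Omega,\mu)$, where $1\le p<\infty$, $p\ne 2$ and $\mu(\Omega)<\infty$. Then $\mathcal{B}_{nat}(B_E)\subsetneq\mathcal{B}_{inv}(B_E)$.
   Context: For a complex Banach space $E$ with open unit ball $B_E$, $H(B_E)$ is the space of holomorphic (complex Fréchet differentiable) functions $f:B_E\to\mathbb{C}$, and $Aut(B_E)$ is the set of all biholomorphic bijections $\phi:B_E\to B_E$. For $f\in H(B_E)$ put $\|f\|_{nat}=\sup_{x\in B_E}(1-\|x\|^2)\|f'(x)\|$ and $\|f\|_{inv}=\sup_{\phi\in Aut(B_E)}\|(f\circ\phi)'(0)\|$ (derivatives are elements of $E^*$, with the dual norm). Define $\mathcal{B}_{nat}(B_E)=\{f\in H(B_E):\|f\|_{nat}<\infty\}$ and $\mathcal{B}_{inv}(B_E)=\{f\in H(B_E):\|f\|_{inv}<\infty\}$.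
   Formalization: The formal theorem additionally assumes that E = L_p(Ω,μ) has complex dimension at least 2; for dimension 0 or 1 (e.g. Ω a single point of mass 1, so E = C) the two Bloch spaces coincide and the strict inclusion fails. *)

theory Defs
  imports "HOL-Analysis.Analysis"
begin

class complex_normed_vector = real_normed_vector +
  fixes scaleC :: "complex \<Rightarrow> 'a \<Rightarrow> 'a"  (infixr "*\<^sub>C" 75)
  assumes scaleC_add_right: "c *\<^sub>C (x + y) = c *\<^sub>C x + c *\<^sub>C y"
    and scaleC_add_left: "(c + d) *\<^sub>C x = c *\<^sub>C x + d *\<^sub>C x"
    and scaleC_scaleC: "c *\<^sub>C d *\<^sub>C x = (c * d) *\<^sub>C x"
    and scaleC_of_real: "complex_of_real r *\<^sub>C x = r *\<^sub>R x"
    and norm_scaleC: "norm (c *\<^sub>C x) = cmod c * norm x"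

class complex_banach = complex_normed_vector + complete_space

instantiation complex :: complex_banach
begin

definition scaleC_complex :: "complex \<Rightarrow> complex \<Rightarrow> complex"
  where "scaleC_complex c x = c * x"

instance
  by standard (simp_all add: scaleC_complex_def algebra_simps norm_mult scaleR_conv_of_real)

end

text \<open>
  Complex Frechet differentiability at every point of an open set: the real Frechet derivative
  of the library exists and is complex linear. Functions are total, and nothing is required of
  their values outside the set.
\<close>

definition complex_frechet_holomorphic_on ::
    "('a::complex_normed_vector \<Rightarrow> 'b::complex_normed_vector) \<Rightarrow> 'a set \<Rightarrow> bool"
  where "complex_frechet_holomorphic_on f S \<longleftrightarrow>
    (\<forall>x\<in>S. \<exists>D. (f has_derivative D) (at x) \<and> (\<forall>c v. D (c *\<^sub>C v) = c *\<^sub>C D v))"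

definition Aut_ball :: "('a::complex_banach \<Rightarrow> 'a) set"
  where "Aut_ball = {\<phi>. bij_betw \<phi> (ball 0 1) (ball 0 1)
    \<and> complex_frechet_holomorphic_on \<phi> (ball 0 1)
    \<and> complex_frechet_holomorphic_on (inv_into (ball 0 1) \<phi>) (ball 0 1)}"

definition nat_seminorm :: "('a::complex_banach \<Rightarrow> complex) \<Rightarrow> ennreal"
  where "nat_seminorm f =
    (SUP x\<in>ball 0 1. ennreal ((1 - (norm x)\<^sup>2) * onorm (frechet_derivative f (at x))))"

definition inv_seminorm :: "('a::complex_banach \<Rightarrow> complex) \<Rightarrow> ennreal"
  where "inv_seminorm f =
    (SUP \<phi>\<in>Aut_ball. ennreal (onorm (frechet_derivative (f \<circ> \<phi>) (at 0))))"

definition Bloch_nat :: "('a::complex_banach \<Rightarrow> complex) set"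
  where "Bloch_nat = {f. complex_frechet_holomorphic_on f (ball 0 1) \<and> nat_seminorm f < \<infinity>}"

definition Bloch_inv :: "('a::complex_banach \<Rightarrow> complex) set"
  where "Bloch_inv = {f. complex_frechet_holomorphic_on f (ball 0 1) \<and> inv_seminorm f < \<infinity>}"

definition Lp_functions :: "'w measure \<Rightarrow> real \<Rightarrow> ('w \<Rightarrow> complex) set"
  where "Lp_functions M p =
    {f \<in> borel_measurable M. integrable M (\<lambda>w. cmod (f w) powr p)}"

definition Lp_norm :: "'w measure \<Rightarrow> real \<Rightarrow> ('w \<Rightarrow> complex) \<Rightarrow> real"
  where "Lp_norm M p f = (\<integral>w. cmod (f w) powr p \<partial>M) powr (1 / p)"

text \<open>
  A type cannot depend on the measure \<open>M\<close>, so \<open>L\<^sub>p(M)\<close> is given as a Banach space together with the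
  map \<open>T\<close> sending a \<open>p\<close>-integrable function to its class. The conditions determine the space up
  to isometric isomorphism: by the lemma below, the fibres of \<open>T\<close> are the classes of functions
  modulo equality almost everywhere.
\<close>

definition is_Lp_space ::
    "'w measure \<Rightarrow> real \<Rightarrow> (('w \<Rightarrow> complex) \<Rightarrow> 'a::complex_banach) \<Rightarrow> bool"
  where "is_Lp_space M p T \<longleftrightarrow>
    (\<forall>f\<in>Lp_functions M p. \<forall>g\<in>Lp_functions M p. T (\<lambda>w. f w + g w) = T f + T g) \<and>
    (\<forall>c. \<forall>f\<in>Lp_functions M p. T (\<lambda>w. c * f w) = c *\<^sub>C T f) \<and>
    (\<forall>f\<in>Lp_functions M p. norm (T f) = Lp_norm M p f) \<and>
    T ` Lp_functions M p = UNIV"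

lemma Lp_functions_diff:
  assumes "f \<in> Lp_functions M p" "g \<in> Lp_functions M p" "1 \<le> p"
  shows "(\<lambda>w. f w - g w) \<in> Lp_functions M p"
proof -
  have [measurable]: "f \<in> borel_measurable M" "g \<in> borel_measurable M"
    using assms by (auto simp: Lp_functions_def)
  have le: "cmod (a - b) powr p \<le> 2 powr p * (cmod a powr p + cmod b powr p)" for a b
  proof -
    have "cmod (a - b) \<le> 2 * max (cmod a) (cmod b)"
      using norm_triangle_ineq4[of a b] by linarith
    then have "cmod (a - b) powr p \<le> (2 * max (cmod a) (cmod b)) powr p"
      using assms(3) by (intro powr_mono2) auto
    also have "\<dots> = 2 powr p * max (cmod a) (cmod b) powr p"
      by (simp add: powr_mult)
    also have "\<dots> \<le> 2 powr p * (cmod a powr p + cmod b powr p)"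
      by (intro mult_left_mono) (auto simp: max_def)
    finally show ?thesis .
  qed
  have "integrable M (\<lambda>w. 2 powr p * (cmod (f w) powr p + cmod (g w) powr p))"
    using assms by (auto simp: Lp_functions_def)
  then have "integrable M (\<lambda>w. cmod (f w - g w) powr p)"
    by (rule Bochner_Integration.integrable_bound) (auto intro!: AE_I2 order_trans[OF le])
  then show ?thesis
    by (simp add: Lp_functions_def)
qed

lemma is_Lp_space_eq_iff:
  assumes "is_Lp_space M p T" "1 \<le> p" "f \<in> Lp_functions M p" "g \<in> Lp_functions M p"
  shows "T f = T g \<longleftrightarrow> (AE w in M. f w = g w)"
proof -
  let ?h = "\<lambda>w. f w - g w"
  have h: "?h \<in> Lp_functions M p"
    using Lp_functions_diff assms by blast
  have "T (\<lambda>w. ?h w + g w) = T ?h + T g"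
    using assms(1,4) h unfolding is_Lp_space_def by fast
  then have "T f = T g \<longleftrightarrow> norm (T ?h) = 0"
    by simp
  also have "\<dots> \<longleftrightarrow> (\<integral>w. cmod (?h w) powr p \<partial>M) = 0"
    using assms(1) h by (simp add: is_Lp_space_def Lp_norm_def)
  also have "\<dots> \<longleftrightarrow> (AE w in M. cmod (?h w) powr p = 0)"
    using h by (intro integral_nonneg_eq_0_iff_AE) (auto simp: Lp_functions_def)
  finally show ?thesis
    by simp
qed

end

theory Submission
  imports Defs "HOL-Complex_Analysis.Complex_Analysis"
begin

text \<open>
  Every automorphism \<open>\<phi>\<close> of the unit ball of \<open>L\<^sub>p\<close> fixes the origin when \<open>p \<noteq> 2\<close>. Then
  \<open>(f \<circ> \<phi>)' 0 = f' 0 \<circ> \<phi>' 0\<close> has norm at most that of \<open>f' 0\<close>, so \<open>B_inv\<close> contains all holomorphic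
  functions, while \<open>1 / (1 - l)\<close> is not in \<open>B_nat\<close> for a norming functional \<open>l\<close> of a unit vector.

  Let \<open>\<psi>\<close> be the inverse of \<open>\<phi>\<close> and consider the maps \<open>z \<mapsto> \<phi> (c \<psi> z)\<close>, which send the ball to
  itself for \<open>|c| \<le> 1\<close> and are the identity for \<open>c = 1\<close>. Compress them to the copy of the two-dimensional
  \<open>l\<^sub>p\<close> spanned by normalised indicators of two disjoint sets. Pairing with the support functional of
  \<open>(x, s)\<close>, where \<open>x\<^sup>p + s\<^sup>p = 1\<close>, gives functions of \<open>\<zeta>\<close> on the unit disc, bounded by one, which are
  \<open>\<zeta>\<close> at \<open>c = 1\<close>. Since \<open>c = 1\<close> is extremal, the \<open>c\<close>-derivatives there of the coefficients of
  \<open>1\<close> and \<open>\<zeta>\<^sup>2\<close> are conjugate. For each \<open>x\<close> in \<open>(0, 1]\<close> this is the identity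
  \<open>x\<^sup>p\<^sup>+\<^sup>1 q\<^sub>1 + (1 - x\<^sup>p) x q\<^sub>2 = x\<^sup>p\<^sup>-\<^sup>1 cnj a\<close>, where \<open>q\<^sub>1\<close>, \<open>q\<^sub>2\<close>, \<open>a\<close> do not depend on \<open>x\<close>
  and \<open>a\<close> is a coordinate of \<open>\<phi>' (\<psi> 0) (\<psi> 0)\<close>. The values \<open>x = 1, 1/2, 1/4\<close> force \<open>a = 0\<close> unless
  \<open>p = 2\<close>. Varying the sets gives \<open>\<phi>' (\<psi> 0) (\<psi> 0) = 0\<close>, hence \<open>\<psi> 0 = 0\<close>.
\<close>

subsection \<open>Holomorphic families of functions on a disc\<close>

text \<open>The derivative at \<open>w\<close> is a limit of difference quotients, each holomorphic
  in \<open>a\<close>. Cauchy's estimate bounds the second derivatives independently of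
  \<open>a\<close>, so Taylor's formula makes the convergence uniform on \<open>S\<close>.\<close>

lemma holomorphic_deriv_parameter:
  assumes S: "open S" and r: "0 < r"
    and F: "\<And>a. a \<in> S \<Longrightarrow> F a holomorphic_on ball w r"
    and bound: "\<And>a z. a \<in> S \<Longrightarrow> z \<in> ball w r \<Longrightarrow> cmod (F a z) \<le> C"
    and par: "\<And>z. z \<in> ball w r \<Longrightarrow> (\<lambda>a. F a z) holomorphic_on S"
  shows "(\<lambda>a. deriv (F a) w) holomorphic_on S"
proof (rule holomorphic_uniform_sequence[OF S])
  define h where "h n = complex_of_real (r / 2 / (real n + 2))" for n
  define q where "q n a = (F a (w + h n) - F a w) / h n" for n a
  have h: "cmod (h n) = r / 2 / (real n + 2)" "h n \<noteq> 0" for n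
    using r unfolding h_def norm_of_real of_real_eq_0_iff by simp_all
  have hr: "cmod (h n) < r / 2" for n
  proof -
    have "r / 2 / (real n + 2) < r / 2 / 1"
      using r by (intro divide_strict_left_mono) auto
    then show ?thesis
      unfolding h by simp
  qed
  have mem: "w + h n \<in> ball w r" for n
  proof -
    have "cmod (h n) < r"
      using hr[of n] r by linarith
    then show ?thesis
      by (simp add: dist_norm)
  qed
  show "q n holomorphic_on S" for n
    unfolding q_def by (intro holomorphic_on_divide holomorphic_on_diff holomorphic_on_const par mem h) (simp add: r)
  \<comment> \<open>Cauchy's estimate for the second derivative,
    \<open>fact 2 * C / (r/4) ^ 2\<close>, on circles of radius \<open>r/4\<close> about points of
    \<open>ball w (r/2)\<close>.\<close>
  define B where "B = 2 * C / (r / 4) ^ 2"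
  have err: "cmod (q n a - deriv (F a) w) \<le> B * cmod (h n)" if "a \<in> S" for n a
  proof -
    have "cmod ((deriv ^^ 0) (F a) (w + h n) - (\<Sum>i\<le>1. (deriv ^^ i) (F a) w * ((w + h n) - w) ^ i / fact i))
      \<le> B * cmod ((w + h n) - w) ^ Suc 1 / fact 1"
    proof (rule field_Taylor[where S = "ball w (r/2)"])
      show "((deriv ^^ i) (F a) has_field_derivative (deriv ^^ Suc i) (F a) x) (at x within ball w (r/2))"
        if "x \<in> ball w (r/2)" for i x
      proof -
        have "(deriv ^^ i) (F a) holomorphic_on ball w r"
          using F[OF \<open>a \<in> S\<close>] by (intro holomorphic_higher_deriv) auto
        moreover have "x \<in> ball w r"
          using that r by simp
        ultimately have "((deriv ^^ i) (F a) has_field_derivative (deriv ^^ Suc i) (F a) x) (at x)"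
          using holomorphic_derivI[OF _ open_ball] by simp
        then show ?thesis
          by (rule has_field_derivative_at_within)
      qed
      show "norm ((deriv ^^ Suc 1) (F a) x) \<le> B" if x: "x \<in> ball w (r/2)" for x
      proof -
        have sub: "cball x (r/4) \<subseteq> ball w r"
        proof
          fix y assume "y \<in> cball x (r/4)"
          then show "y \<in> ball w r"
            using x r dist_triangle[of w y x] by simp
        qed
        have hol: "F a holomorphic_on cball x (r/4)"
          using F[OF \<open>a \<in> S\<close>] sub by (rule holomorphic_on_subset)
        have "norm ((deriv ^^ 2) (F a) x) \<le> fact 2 * C / (r/4) ^ 2"
        proof (rule Cauchy_inequality)
          show "F a holomorphic_on ball x (r/4)"
            using hol by (rule holomorphic_on_subset) auto
          show "continuous_on (cball x (r/4)) (F a)"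
            using hol by (rule holomorphic_on_imp_continuous_on)
          show "cmod (F a y) \<le> C" if "cmod (x - y) = r/4" for y
            using that sub by (intro bound \<open>a \<in> S\<close>) (auto simp: dist_norm)
        qed (use r in auto)
        then show ?thesis
          by (simp add: B_def numeral_2_eq_2)
      qed
    next
      show "w + h n \<in> ball w (r/2)"
        using hr[of n] by (simp add: dist_norm)
    qed (use r in auto)
    moreover have "(\<Sum>i\<le>1. (deriv ^^ i) (F a) w * ((w + h n) - w) ^ i / fact i) = F a w + deriv (F a) w * h n"
      by (simp add: atMost_Suc)
    moreover have "B * cmod ((w + h n) - w) ^ Suc 1 / fact 1 = B * cmod (h n) ^ 2"
      by (simp add: power2_eq_square)
    ultimately have "cmod (F a (w + h n) - F a w - deriv (F a) w * h n) \<le> B * cmod (h n) ^ 2"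
      by (simp only: funpow_0 diff_diff_eq)
    moreover have "q n a - deriv (F a) w = (F a (w + h n) - F a w - deriv (F a) w * h n) / h n"
      using h(2)[of n] by (simp add: q_def field_simps)
    ultimately show ?thesis
      using h(2)[of n] by (simp add: norm_divide pos_divide_le_eq power2_eq_square mult.assoc)
  qed
  have lim: "(\<lambda>n. B * cmod (h n)) \<longlonglongrightarrow> 0"
  proof -
    have "(\<lambda>n. 1 / (real n + 2)) \<longlonglongrightarrow> 0"
      by real_asymp
    then have "(\<lambda>n. B * (r / 2) * (1 / (real n + 2))) \<longlonglongrightarrow> 0"
      by (rule tendsto_mult_right_zero)
    then show ?thesis
      by (simp add: h(1))
  qed
  have "uniform_limit S q (\<lambda>a. deriv (F a) w) sequentially"
    unfolding uniform_limit_iff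
  proof (intro allI impI)
    fix e :: real assume "0 < e"
    then have "\<forall>\<^sub>F n in sequentially. B * cmod (h n) < e"
      using lim by (simp add: order_tendsto_iff)
    then show "\<forall>\<^sub>F n in sequentially. \<forall>a\<in>S. dist (q n a) (deriv (F a) w) < e"
    proof eventually_elim
      case (elim n)
      then show ?case
        unfolding dist_norm using err le_less_trans by blast
    qed
  qed
  then show "\<exists>d>0. cball x d \<subseteq> S \<and> uniform_limit (cball x d) q (\<lambda>a. deriv (F a) w) sequentially"
    if x: "x \<in> S" for x
  proof -
    obtain d where "d > 0" "cball x d \<subseteq> S"
      using x S open_contains_cball[of S] by blast
    then show ?thesis
      using \<open>uniform_limit S _ _ _\<close> uniform_limit_on_subset by blast
  qed
qed

lemma cmod_deriv_le:
  assumes "f holomorphic_on ball w r" "0 < r" "z \<in> ball w (r/2)"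
    and "\<And>z. z \<in> ball w r \<Longrightarrow> cmod (f z) \<le> C"
  shows "cmod (deriv f z) \<le> 4 * C / r"
proof -
  have sub: "cball z (r/4) \<subseteq> ball w r"
  proof
    fix y assume "y \<in> cball z (r/4)"
    then show "y \<in> ball w r"
      using assms(2,3) dist_triangle[of w y z] by simp
  qed
  have hol: "f holomorphic_on cball z (r/4)"
    using assms(1) sub by (rule holomorphic_on_subset)
  have "norm ((deriv ^^ 1) f z) \<le> fact 1 * C / (r/4) ^ 1"
  proof (rule Cauchy_inequality)
    show "f holomorphic_on ball z (r/4)"
      using hol by (rule holomorphic_on_subset) auto
    show "continuous_on (cball z (r/4)) f"
      using hol by (rule holomorphic_on_imp_continuous_on)
    show "cmod (f y) \<le> C" if "cmod (z - y) = r/4" for y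
      using that sub by (intro assms) (auto simp: dist_norm)
  qed (use assms in auto)
  then show ?thesis
    by (simp add: field_simps)
qed

text \<open>Induction on \<open>n\<close> with \<open>F\<close>, \<open>r\<close> and
  \<open>C\<close> free: the differentiated family meets the same hypotheses on the disc of half the
  radius, with bound \<open>4 * C / r\<close>.\<close>

lemma holomorphic_higher_deriv_parameter:
  assumes "open S" "0 < r"
    and "\<And>a. a \<in> S \<Longrightarrow> F a holomorphic_on ball w r"
    and "\<And>a z. a \<in> S \<Longrightarrow> z \<in> ball w r \<Longrightarrow> cmod (F a z) \<le> C"
    and "\<And>z. z \<in> ball w r \<Longrightarrow> (\<lambda>a. F a z) holomorphic_on S"
  shows "(\<lambda>a. (deriv ^^ n) (F a) w) holomorphic_on S"
  using assms(2-)
proof (induction n arbitrary: F r C)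
  case 0
  then show ?case by simp
next
  case (Suc n)
  note hol = Suc.prems(2)
  have "(\<lambda>a. (deriv ^^ n) (deriv (F a)) w) holomorphic_on S"
  proof (rule Suc.IH[where r = "r/2" and C = "4 * C / r"])
    show "deriv (F a) holomorphic_on ball w (r/2)" if "a \<in> S" for a
      using hol[OF that] Suc.prems(1)
      by (intro holomorphic_on_subset[OF holomorphic_deriv, of _ "ball w r"]) auto
    show "cmod (deriv (F a) z) \<le> 4 * C / r" if "a \<in> S" "z \<in> ball w (r/2)" for a z
      using that Suc.prems by (intro cmod_deriv_le) auto
    show "(\<lambda>a. deriv (F a) z) holomorphic_on S" if z: "z \<in> ball w (r/2)" for z
    proof -
      have sub: "y \<in> ball w r" if "y \<in> ball z (r/2)" for y
        using that z dist_triangle[of w y z] by simp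
      show ?thesis
        using sub Suc.prems \<open>open S\<close>
        by (intro holomorphic_deriv_parameter[where r = "r/2" and C = C])
           (auto intro: holomorphic_on_subset[OF hol])
    qed
  qed (use Suc.prems in auto)
  then show ?case
    by (simp add: funpow_Suc_right del: funpow.simps)
qed

section \<open>Taylor coefficients and an extremal argument on the circle\<close>

text \<open>Cauchy's formula on the circle of radius \<open>r\<close>, written as a Fourier
  coefficient so that several coefficients can be combined against one real kernel.\<close>

lemma has_integral_Taylor_coefficient:
  assumes h: "h holomorphic_on cball 0 r" and r: "0 < r"
  shows "((\<lambda>t. h (of_real r * cis t) * cis (- (real n * t))) has_integral
     of_real (2 * pi * r ^ n) * (deriv ^^ n) h 0 / fact n) {0..2 * pi}"
proof -
  have "((\<lambda>u. h u / (u - 0) ^ Suc n) has_contour_integral (2 * pi * \<i>) / fact n * (deriv ^^ n) h 0)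
     (circlepath 0 r)"
    using h r by (intro Cauchy_has_contour_integral_higher_derivative_circlepath)
      (auto intro: holomorphic_on_imp_continuous_on holomorphic_on_subset)
  then have "((\<lambda>t. h (0 + r * cis t) / (0 + r * cis t - 0) ^ Suc n * r * \<i> * cis t) has_integral
      (2 * pi * \<i>) / fact n * (deriv ^^ n) h 0) {0..2*pi}"
    unfolding circlepath_def by (subst (asm) has_contour_integral_part_circlepath_iff) auto
  \<comment> \<open>The factor cancels the \<open>\<i>\<close> and the power of \<open>r\<close>
    left over from the denominator and the speed of the parametrisation.\<close>
  from has_integral_mult_right[OF this, of "of_real (r ^ n) / \<i>"]
  have A: "((\<lambda>t. of_real (r ^ n) / \<i> * (h (0 + r * cis t) / (0 + r * cis t - 0) ^ Suc n * r * \<i> * cis t))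
      has_integral of_real (r ^ n) / \<i> * ((2 * pi * \<i>) / fact n * (deriv ^^ n) h 0)) {0..2*pi}" .
  have f: "of_real (r ^ n) / \<i> * (h (0 + r * cis t) / (0 + r * cis t - 0) ^ Suc n * r * \<i> * cis t)
      = h (of_real r * cis t) * cis (- (real n * t))" for t
  proof -
    have c: "cis t \<noteq> 0" "of_real r \<noteq> (0::complex)" using r by auto
    have "cis (- (real n * t)) = inverse (cis t ^ n)"
      unfolding Complex.DeMoivre by simp
    then show ?thesis
      using c by (simp add: field_simps power_mult_distrib)
  qed
  have v: "of_real (r ^ n) / \<i> * ((2 * pi * \<i>) / fact n * (deriv ^^ n) h 0) =
      of_real (2 * pi * r ^ n) * (deriv ^^ n) h 0 / fact n"
    by (simp add: field_simps del: divide_i)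
  from A show ?thesis
    unfolding f v .
qed

text \<open>The mean of \<open>\<zeta>\<inverse> h(\<zeta>) (1 + Re (k \<zeta>))\<close> over the unit circle; the kernel is
  nonnegative of mean one.\<close>

lemma Fejer_kernel_bound_cball:
  assumes h: "h holomorphic_on cball 0 r" and r: "0 < r"
    and bound: "\<And>z. cmod z = r \<Longrightarrow> cmod (h z) \<le> 1" and k: "cmod k \<le> 1"
  shows "cmod (of_real r * deriv h 0 + (k * h 0 + cnj k * (of_real (r^2) * (deriv ^^ 2) h 0 / 2)) / 2) \<le> 1"
proof -
  define g where "g t = h (of_real r * cis t) * cis (- t) * of_real (1 + Re (k * cis t))" for t
  define I where "I = of_real (2 * pi) * (of_real r * deriv h 0 + (k * h 0 + cnj k * (of_real (r^2) * (deriv ^^ 2) h 0 / 2)) / 2)"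
  note coef = has_integral_Taylor_coefficient[OF h r]
  have g: "(g has_integral I) {0..2*pi}"
  proof -
    have A: "((\<lambda>t. h (of_real r * cis t) * cis (- (real 1 * t)) +
        (k * (h (of_real r * cis t) * cis (- (real 0 * t))) +
         cnj k * (h (of_real r * cis t) * cis (- (real 2 * t)))) * (1/2)) has_integral
       of_real (2 * pi * r ^ 1) * (deriv ^^ 1) h 0 / fact 1 +
        (k * (of_real (2 * pi * r ^ 0) * (deriv ^^ 0) h 0 / fact 0) +
         cnj k * (of_real (2 * pi * r ^ 2) * (deriv ^^ 2) h 0 / fact 2)) * (1/2)) {0..2*pi}"
      by (intro has_integral_add has_integral_mult_left has_integral_mult_right coef)
    have f: "h (of_real r * cis t) * cis (- (real 1 * t)) +
        (k * (h (of_real r * cis t) * cis (- (real 0 * t))) +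
         cnj k * (h (of_real r * cis t) * cis (- (real 2 * t)))) * (1/2) = g t" for t
    proof -
      \<comment> \<open>The real part is half the sum of a number and its conjugate; the two
        exponentials shift the coefficient of order 1 to those of order 0 and 2.\<close>
      have "of_real (1 + Re (k * cis t)) = 1 + (k * cis t + cnj k * cis (- t)) / 2"
        using complex_add_cnj[of "k * cis t"] by (simp add: cis_cnj)
      moreover have "cis (- (real 2 * t)) = cis (- t) * cis (- t)" "cis (- t) * cis t = 1"
        by (simp_all add: cis_mult)
      ultimately show ?thesis
        unfolding g_def by (simp add: algebra_simps)
    qed
    have v: "of_real (2 * pi * r ^ 1) * (deriv ^^ 1) h 0 / fact 1 +
        (k * (of_real (2 * pi * r ^ 0) * (deriv ^^ 0) h 0 / fact 0) +
         cnj k * (of_real (2 * pi * r ^ 2) * (deriv ^^ 2) h 0 / fact 2)) * (1/2) = I"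
      by (simp add: I_def algebra_simps)
    from A show ?thesis
      unfolding f v .
  qed
  have w: "((\<lambda>t. 1 + Re (k * cis t)) has_integral 2 * pi) {0..2*pi}"
  proof -
    have "((\<lambda>t. (1::complex) + k * (cis t)) has_integral of_real (2 * pi) + k * 0) {0..2*pi}"
    proof (intro has_integral_add has_integral_mult_right)
      show "((\<lambda>t. 1) has_integral complex_of_real (2 * pi)) {0..2 * pi}"
        using has_integral_const_real[of "1::complex" 0 "2*pi"] by (simp add: scaleR_conv_of_real)
      have "((\<lambda>t. of_real 1 * cis t) has_integral 0) {0..2 * pi}"
        using has_integral_Taylor_coefficient[of "\<lambda>z. z" 1 0] by simp
      then show "(cis has_integral 0) {0..2 * pi}" by simp
    qed
    from has_integral_Re[OF this] show ?thesis by simp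
  qed
  have "cmod I \<le> 2 * pi"
  proof -
    have "cmod (g t) \<le> 1 + Re (k * cis t)" for t
    proof -
      have "\<bar>Re (k * cis t)\<bar> \<le> 1"
        using abs_Re_le_cmod[of "k * cis t"] k by (simp add: norm_mult)
      moreover have "cmod (h (of_real r * cis t)) \<le> 1"
        using r by (intro bound) (simp add: norm_mult)
      ultimately have "cmod (g t) \<le> 1 * (1 + Re (k * cis t))"
        unfolding g_def norm_mult by (intro mult_mono) (auto simp del: of_real_add)
      then show ?thesis by simp
    qed
    then have "cmod (integral {0..2*pi} g) \<le> integral {0..2*pi} (\<lambda>t. 1 + Re (k * cis t))"
      using g w by (intro integral_norm_bound_integral) (auto simp: integrable_on_def)
    then show ?thesis
      using g w by (simp add: integral_unique)
  qed
  then show ?thesis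
    unfolding I_def norm_mult by simp
qed

text \<open>The function need not extend to the closed disc, so the bound on circles of radius
  \<open>r < 1\<close> is used and \<open>r\<close> tends to one.\<close>

lemma Fejer_kernel_bound:
  assumes h: "h holomorphic_on ball 0 1"
    and bound: "\<And>z. z \<in> ball 0 1 \<Longrightarrow> cmod (h z) \<le> 1" and k: "cmod k \<le> 1"
  shows "cmod (deriv h 0 + (k * h 0 + cnj k * ((deriv ^^ 2) h 0 / 2)) / 2) \<le> 1"
proof (rule tendsto_upperbound)
  let ?f = "\<lambda>r::real. cmod (of_real r * deriv h 0 + (k * h 0 + cnj k * (of_real (r^2) * (deriv ^^ 2) h 0 / 2)) / 2)"
  have "(?f \<longlongrightarrow> ?f 1) (at_left 1)"
    by (intro tendsto_intros) simp_all
  then show "(?f \<longlongrightarrow> cmod (deriv h 0 + (k * h 0 + cnj k * ((deriv ^^ 2) h 0 / 2)) / 2)) (at_left 1)"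
    by simp
  have "\<forall>\<^sub>F r::real in at_left 1. 0 < r \<and> r < 1"
    using eventually_at_left[of 0 "1::real"] by (auto intro: exI[of _ 0])
  then show "\<forall>\<^sub>F r in at_left 1. ?f r \<le> 1"
  proof eventually_elim
    case (elim r)
    then have "h holomorphic_on cball 0 r"
      using h by (auto intro: holomorphic_on_subset)
    then show ?case
      using elim k by (intro Fejer_kernel_bound_cball bound) auto
  qed
qed simp

text \<open>Along the unit circle the real part of \<open>G\<close> has its maximum at the point
  one, and its derivative there is \<open>Re (\<i> * D)\<close>.\<close>

lemma deriv_real_at_maximum:
  assumes "(G has_field_derivative D) (at 1)"
    and "\<And>l. cmod l = 1 \<Longrightarrow> cmod (G l) \<le> 1" "G 1 = 1"
  shows "Im D = 0"
proof -
  have G: "(G has_field_derivative D) (at (exp (\<i> * of_real 0)))"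
    using assms(1) by simp
  have "((\<lambda>t. exp (\<i> * of_real t)) has_vector_derivative \<i>) (at 0)"
    by (rule has_vector_derivative_real_field) (auto intro!: derivative_eq_intros)
  from field_vector_diff_chain_at[OF this G]
  have "((\<lambda>t. G (exp (\<i> * of_real t))) has_vector_derivative \<i> * D) (at 0)"
    by (simp add: o_def)
  from bounded_linear.has_vector_derivative[OF bounded_linear_Re this]
  have "((\<lambda>t. Re (G (exp (\<i> * of_real t)))) has_real_derivative Re (\<i> * D)) (at 0)"
    by (simp add: has_real_derivative_iff_has_vector_derivative)
  moreover have "Re (G (exp (\<i> * of_real t))) \<le> Re (G (exp (\<i> * of_real 0)))" for t
  proof -
    have "Re (G (exp (\<i> * of_real t))) \<le> cmod (G (exp (\<i> * of_real t)))"
      by (rule complex_Re_le_cmod)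
    also have "\<dots> \<le> 1"
      by (intro assms) simp
    finally show ?thesis
      using assms by simp
  qed
  ultimately have "Re (\<i> * D) = 0"
    by (intro DERIV_local_max[of "\<lambda>t. Re (G (exp (\<i> * of_real t)))" _ 0 1]) auto
  then show ?thesis by simp
qed

text \<open>For each \<open>k\<close> the combination in \<open>Fejer_kernel_bound\<close> has
  modulus at most one on \<open>cmod l = 1\<close> and equals one at \<open>l = 1\<close>, so its
  derivative there is real. For other \<open>l\<close> near one the family is controlled only on a
  small disc, which is enough to differentiate its coefficients in \<open>l\<close>.\<close>

lemma disc_family_coefficient_derivatives:
  assumes S: "open S" "1 \<in> S" and r: "0 < r"
    and hol: "\<And>l. l \<in> S \<Longrightarrow> H l holomorphic_on ball 0 r"
    and bound: "\<And>l z. l \<in> S \<Longrightarrow> z \<in> ball 0 r \<Longrightarrow> cmod (H l z) \<le> C"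
    and par: "\<And>z. z \<in> ball 0 r \<Longrightarrow> (\<lambda>l. H l z) holomorphic_on S"
    and disc: "\<And>l. cmod l = 1 \<Longrightarrow> H l holomorphic_on ball 0 1"
      "\<And>l z. cmod l = 1 \<Longrightarrow> z \<in> ball 0 1 \<Longrightarrow> cmod (H l z) \<le> 1"
    and id: "\<And>z. z \<in> ball 0 1 \<Longrightarrow> H 1 z = z"
  shows "deriv (\<lambda>l. (deriv ^^ 2) (H l) 0 / 2) 1 = cnj (deriv (\<lambda>l. H l 0) 1)"
proof -
  have c: "((\<lambda>l. (deriv ^^ n) (H l) 0) has_field_derivative deriv (\<lambda>l. (deriv ^^ n) (H l) 0) 1) (at 1)" for n
    using holomorphic_higher_deriv_parameter[of S r H 0 C n] assms
    by (auto intro!: holomorphic_derivI[of _ S])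
  define d0 where "d0 = deriv (\<lambda>l. H l 0) 1"
  define d1 where "d1 = deriv (\<lambda>l. deriv (H l) 0) 1"
  define d2 where "d2 = deriv (\<lambda>l. (deriv ^^ 2) (H l) 0 / 2) 1"
  have c0: "((\<lambda>l. H l 0) has_field_derivative d0) (at 1)"
    using c[of 0] by (simp add: d0_def)
  have c1: "((\<lambda>l. deriv (H l) 0) has_field_derivative d1) (at 1)"
    using c[of 1] by (simp add: d1_def)
  have c2: "((\<lambda>l. (deriv ^^ 2) (H l) 0 / 2) has_field_derivative d2) (at 1)"
    using DERIV_cdivide[OF c[of 2], of 2] unfolding d2_def by (metis DERIV_deriv_iff_field_differentiable field_differentiable_def)
  have ev: "\<forall>\<^sub>F z in nhds 0. H 1 z = z"
    using id by (intro eventually_nhds_in_open[THEN eventually_mono, of "ball 0 1"]) auto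
  have H1: "H 1 0 = 0" "deriv (H 1) 0 = 1" "(deriv ^^ 2) (H 1) 0 = 0"
    using id higher_deriv_cong_ev[OF ev refl, of 2] deriv_cong_ev[OF ev refl]
    by (auto simp: numeral_2_eq_2)
  have key: "Im (d1 + (k * d0 + cnj k * d2) / 2) = 0" if "cmod k \<le> 1" for k
  proof (rule deriv_real_at_maximum)
    show "((\<lambda>l. deriv (H l) 0 + (k * H l 0 + cnj k * ((deriv ^^ 2) (H l) 0 / 2)) / 2)
        has_field_derivative d1 + (k * d0 + cnj k * d2) / 2) (at 1)"
      by (intro derivative_intros DERIV_cdivide DERIV_cmult DERIV_add c0 c1 c2)
    show "cmod (deriv (H l) 0 + (k * H l 0 + cnj k * ((deriv ^^ 2) (H l) 0 / 2)) / 2) \<le> 1" if "cmod l = 1" for l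
      using disc that \<open>cmod k \<le> 1\<close> by (intro Fejer_kernel_bound)
  qed (simp add: H1)
  \<comment> \<open>\<open>k = 0\<close> isolates \<open>d1\<close>; \<open>k = 1\<close> and
    \<open>k = \<i>\<close> then compare the imaginary and the real parts of \<open>d0\<close> and
    \<open>d2\<close>.\<close>
  have "Im d1 = 0" "Im (d0 + d2) = 0" "Re (d0 - d2) = 0"
    using key[of 0] key[of 1] key[of \<i>] by simp_all
  then have "d2 = cnj d0"
    by (simp add: complex_eq_iff)
  then show ?thesis
    by (simp add: d0_def d2_def)
qed

subsection \<open>Complex Frechet differentiability\<close>

lemma complex_frechet_holomorphic_onD:
  assumes "complex_frechet_holomorphic_on f S" "x \<in> S"
  shows "\<exists>D. (f has_derivative D) (at x) \<and> (\<forall>c v. D (c *\<^sub>C v) = c *\<^sub>C D v)"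
  using assms unfolding complex_frechet_holomorphic_on_def by (rule bspec)

lemma complex_frechet_holomorphic_on_compose:
  assumes "complex_frechet_holomorphic_on f S" "complex_frechet_holomorphic_on g T" "f ` S \<subseteq> T"
  shows "complex_frechet_holomorphic_on (\<lambda>x. g (f x)) S"
  unfolding complex_frechet_holomorphic_on_def
proof
  fix x assume x: "x \<in> S"
  obtain D where D: "(f has_derivative D) (at x)" "\<And>c v. D (c *\<^sub>C v) = c *\<^sub>C D v"
    using complex_frechet_holomorphic_onD[OF assms(1) x] by blast
  have "f x \<in> T" using x assms(3) by blast
  then obtain E where E: "(g has_derivative E) (at (f x))" "\<And>c v. E (c *\<^sub>C v) = c *\<^sub>C E v"
    using complex_frechet_holomorphic_onD[OF assms(2)] by blast
  have "((\<lambda>x. g (f x)) has_derivative (\<lambda>v. E (D v))) (at x)"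
    using has_derivative_compose[OF D(1)] E(1) by blast
  then show "\<exists>D. ((\<lambda>x. g (f x)) has_derivative D) (at x) \<and> (\<forall>c v. D (c *\<^sub>C v) = c *\<^sub>C D v)"
    using D(2) E(2) by auto
qed

lemma complex_frechet_holomorphic_on_imp_holomorphic_on:
  assumes "complex_frechet_holomorphic_on f S"
  shows "f holomorphic_on S"
  unfolding holomorphic_on_def
proof
  fix x assume "x \<in> S"
  then obtain D where D: "(f has_derivative D) (at x)" "\<And>c v. D (c *\<^sub>C v) = c *\<^sub>C D v"
    using complex_frechet_holomorphic_onD[OF assms] by blast
  have "D = (*) (D 1)"
  proof
    fix c
    show "D c = D 1 * c"
      using D(2)[of c 1] by (simp only: scaleC_complex_def mult_1_right mult.commute[of "D 1"])
  qed
  then have "(f has_field_derivative D 1) (at x)"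
    using D(1) by (simp add: has_field_derivative_def)
  then show "f field_differentiable at x within S"
    using field_differentiable_at_within field_differentiable_def by blast
qed

lemma complex_frechet_holomorphic_on_imp_continuous_on:
  "complex_frechet_holomorphic_on f S \<Longrightarrow> continuous_on S f"
  unfolding complex_frechet_holomorphic_on_def
  by (meson continuous_at_imp_continuous_on has_derivative_continuous)

lemma bounded_linear_scaleC_left: "bounded_linear (\<lambda>c. c *\<^sub>C (b::'a::complex_normed_vector))"
proof (rule bounded_linear_intro[where K = "norm b"])
  show "(r *\<^sub>R x) *\<^sub>C b = r *\<^sub>R x *\<^sub>C b" for r x
    by (metis scaleC_of_real scaleC_scaleC scaleR_conv_of_real)
qed (simp_all add: scaleC_add_left norm_scaleC)

lemma bounded_linear_scaleC_right: "bounded_linear (\<lambda>b. c *\<^sub>C (b::'a::complex_normed_vector))"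
proof (rule bounded_linear_intro[where K = "cmod c"])
  show "c *\<^sub>C (r *\<^sub>R x) = r *\<^sub>R c *\<^sub>C x" for r and x :: 'a
    by (metis scaleC_of_real scaleC_scaleC mult.commute)
qed (simp_all add: scaleC_add_right norm_scaleC)

lemma complex_frechet_holomorphic_on_affine:
  fixes a :: "'b::complex_normed_vector"
  assumes "bounded_linear L" "\<And>c v. L (c *\<^sub>C v) = c *\<^sub>C L v"
  shows "complex_frechet_holomorphic_on (\<lambda>x. a + L x) S"
  unfolding complex_frechet_holomorphic_on_def
proof (intro ballI exI conjI allI)
  fix x
  show "((\<lambda>x. a + L x) has_derivative L) (at x)"
    using has_derivative_add[OF has_derivative_const[of a] bounded_linear_imp_has_derivative[OF assms(1)]]
    by simp
qed (simp add: assms(2))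

lemma complex_frechet_holomorphic_on_line:
  "complex_frechet_holomorphic_on (\<lambda>c. a + (c * k) *\<^sub>C (b::'a::complex_normed_vector)) S"
proof -
  have "bounded_linear (\<lambda>c. (c * k) *\<^sub>C b)"
    by (rule bounded_linear_compose[OF bounded_linear_scaleC_left bounded_linear_mult_left])
  then show ?thesis
    by (intro complex_frechet_holomorphic_on_affine) (simp_all add: scaleC_complex_def scaleC_scaleC mult.assoc)
qed

section \<open>Young's inequality and the algebra that singles out the exponent two\<close>

text \<open>Young's inequality for the exponents \<open>p / (p - 1)\<close> and \<open>p\<close>,
  multiplied by \<open>p\<close>; this form also makes sense for \<open>p = 1\<close>.\<close>

lemma Young_powr:
  fixes a b p :: real
  assumes "1 \<le> p" "0 \<le> a" "0 \<le> b"
  shows "p * (a powr (p - 1) * b) \<le> (p - 1) * a powr p + b powr p"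
proof (cases "a = 0 \<or> b = 0")
  case False
  then have Y: "(a powr p) powr ((p - 1) / p) * (b powr p) powr (1 / p) \<le> (p - 1) / p * a powr p + 1 / p * b powr p"
    using assms by (intro Youngs_inequality_0) (auto simp: field_simps)
  show ?thesis
  proof -
    have "(p - 1) / p * a powr p + 1 / p * b powr p = ((p - 1) * a powr p + b powr p) / p"
      by (simp add: add_divide_distrib)
    moreover have "(a powr p) powr ((p - 1) / p) = a powr (p - 1)" "(b powr p) powr (1 / p) = b"
      using False assms by (simp_all add: powr_powr)
    ultimately show ?thesis
      using Y assms by (simp add: pos_le_divide_eq mult.commute)
  qed
qed (use assms in auto)

text \<open>Hoelder's inequality in dimension two, from Young's inequality in each coordinate. It
  says that support functionals of the two-dimensional space have norm at most one.\<close>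

lemma powr_pair_le_1:
  fixes x s A B p :: real
  assumes p: "1 \<le> p" and nn: "0 \<le> x" "0 \<le> s" "0 \<le> A" "0 \<le> B"
    and "x powr p + s powr p \<le> 1" "A powr p + B powr p \<le> 1"
  shows "x powr (p - 1) * A + s powr (p - 1) * B \<le> 1"
proof -
  have "p * (x powr (p - 1) * A) + p * (s powr (p - 1) * B)
      \<le> (p - 1) * (x powr p + s powr p) + (A powr p + B powr p)"
    using Young_powr[OF p, of x A] Young_powr[OF p, of s B] nn by (simp add: algebra_simps)
  also have "\<dots> \<le> (p - 1) * 1 + 1"
    using assms by (intro add_mono mult_left_mono) auto
  finally have "p * (x powr (p - 1) * A + s powr (p - 1) * B) \<le> p * 1"
    by (simp add: algebra_simps)
  then show ?thesis
    using p by simp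
qed

text \<open>Gives the second Taylor coefficient of the slices below. The factor \<open>z\<close>
  shifts \<open>g\<close> by one order, so only the first derivative of \<open>g\<close>
  enters.\<close>

lemma second_derivative_combination:
  assumes f: "f holomorphic_on ball 0 r" and g: "g holomorphic_on ball 0 r"
    and r: "0 < r" and x: "cmod x \<le> 1"
  shows "(deriv ^^ 2) (\<lambda>z. c * f (z * x) + d * z * g (z * x)) 0
    = c * x\<^sup>2 * (deriv ^^ 2) f 0 + 2 * d * x * deriv g 0"
proof -
  have mem: "z * x \<in> ball 0 r" if "z \<in> ball 0 r" for z
    using that x mult_left_mono[of "cmod x" 1 "cmod z"] by (simp add: norm_mult)
  have chain: "((\<lambda>z. h (z * x)) has_field_derivative deriv h (z * x) * x) (at z)"
    if "h holomorphic_on ball 0 r" "z \<in> ball 0 r" for h z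
  proof (rule DERIV_chain2[where g = "\<lambda>z. z * x" and f = h])
    show "(h has_field_derivative deriv h (z * x)) (at (z * x))"
      using that mem by (intro holomorphic_derivI[of h "ball 0 r"]) auto
    show "((\<lambda>z. z * x) has_field_derivative x) (at z)"
      by (auto intro!: derivative_eq_intros)
  qed
  let ?h = "\<lambda>z. c * f (z * x) + d * z * g (z * x)"
  let ?h' = "\<lambda>z. c * (deriv f (z * x) * x) + (d * z * (deriv g (z * x) * x) + d * g (z * x))"
  have "(?h has_field_derivative ?h' z) (at z)" if "z \<in> ball 0 r" for z
  proof -
    have "((\<lambda>z. d * z) has_field_derivative d) (at z)"
      by (auto intro!: derivative_eq_intros)
    from DERIV_add[OF DERIV_cmult[OF chain[OF f that]] DERIV_mult'[OF this chain[OF g that]]]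
    show ?thesis .
  qed
  then have d1: "deriv ?h z = ?h' z" if "z \<in> ball 0 r" for z
    using that DERIV_imp_deriv by blast
  have f': "deriv f holomorphic_on ball 0 r" and g': "deriv g holomorphic_on ball 0 r"
    using f g by (auto intro: holomorphic_deriv)
  have z: "(0::complex) \<in> ball 0 r" using r by simp
  have "((\<lambda>z. d * z) has_field_derivative d) (at 0)"
    by (auto intro!: derivative_eq_intros)
  from DERIV_add[OF DERIV_cmult[OF DERIV_cmult_right[OF chain[OF f' z]]]
      DERIV_add[OF DERIV_mult'[OF this DERIV_cmult_right[OF chain[OF g' z]]] DERIV_cmult[OF chain[OF g z]]], of c x x d]
  have "(?h' has_field_derivative c * (deriv (deriv f) (0 * x) * x * x) +
      (d * 0 * (deriv (deriv g) (0 * x) * x * x) + d * (deriv g (0 * x) * x) + d * (deriv g (0 * x) * x))) (at 0)" .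
  from DERIV_imp_deriv[OF this]
  have "deriv ?h' 0 = c * x\<^sup>2 * deriv (deriv f) 0 + 2 * d * x * deriv g 0"
    by (simp add: power2_eq_square algebra_simps)
  moreover have "deriv (deriv ?h) 0 = deriv ?h' 0"
    using d1 r by (intro deriv_cong_ev eventually_nhds_in_open[THEN eventually_mono, of "ball 0 r"]) auto
  ultimately show ?thesis
    by (simp add: numeral_2_eq_2)
qed

text \<open>At \<open>x = 1\<close> the identity gives \<open>q1 = a\<close>. With
  \<open>P = (1/2) powr p\<close>, the values \<open>1/2\<close> and \<open>1/4\<close> give two
  linear equations in \<open>a\<close> and \<open>q2\<close>, and eliminating \<open>q2\<close>
  leaves \<open>P * (4 * P - 1) = 0\<close>.\<close>

lemma exponent_eq_2:
  fixes a q1 q2 :: complex and p :: real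
  assumes eq: "\<And>x. 0 < x \<Longrightarrow> x \<le> 1 \<Longrightarrow>
      of_real (x powr (p - 1)) * of_real x ^ 2 * q1 + of_real (1 - x powr p) * of_real x * q2
        = of_real (x powr (p - 1)) * a"
    and "a \<noteq> 0"
  shows "p = 2"
proof -
  \<comment> \<open>The identity times \<open>x\<close>, with \<open>q1 = a\<close> inserted; only
    the powers \<open>x ^ 2\<close> and \<open>x powr p\<close> remain.\<close>
  have red: "of_real (x ^ 2 * x powr p - x powr p) * a = - of_real (x ^ 2 * (1 - x powr p)) * q2"
    if x: "0 < x" "x \<le> 1" for x
  proof -
    have "q1 = a" using eq[of 1] by simp
    moreover have "of_real x * of_real (x powr (p - 1)) = (of_real (x powr p) :: complex)"
      using x powr_mult_base[of x "p - 1"] by (simp flip: of_real_mult)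
    ultimately have "of_real (x powr p) * of_real x ^ 2 * a + of_real (1 - x powr p) * of_real x ^ 2 * q2
       = of_real (x powr p) * a"
      using arg_cong[OF eq[OF x], of "\<lambda>z. of_real x * z"]
      by (simp add: algebra_simps power2_eq_square)
    then show ?thesis
      by (simp add: algebra_simps)
  qed
  define P where "P = (1/2::real) powr p"
  have "(1/4::real) powr p = P ^ 2"
    unfolding P_def using powr_mult[of "1/2" "1/2" p] by (simp add: power2_eq_square)
  then have "of_real (1/16 * P ^ 2 - P ^ 2) * a = - of_real (1/16 * (1 - P ^ 2)) * q2"
    using red[of "1/4"] by (simp add: power2_eq_square)
  then have e2: "of_real (15 * P ^ 2) * a = of_real (1 - P ^ 2) * q2"
    by (simp add: field_simps)
  have "of_real (1/4 * P - P) * a = - of_real (1/4 * (1 - P)) * q2"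
    using red[of "1/2"] by (simp add: P_def power2_eq_square)
  then have e1: "of_real (3 * P) * a = of_real (1 - P) * q2"
    by (simp add: field_simps)
  \<comment> \<open>Since \<open>1 - P ^ 2 = (1 + P) * (1 - P)\<close>, the right side of
    \<open>e2\<close> is a multiple of that of \<open>e1\<close>.\<close>
  have "of_real (15 * P ^ 2) * a = of_real (1 + P) * (of_real (1 - P) * q2)"
    unfolding e2 by (simp add: algebra_simps power2_eq_square)
  also have "\<dots> = of_real ((1 + P) * (3 * P)) * a"
    unfolding e1[symmetric] by simp
  finally have "15 * P ^ 2 = (1 + P) * (3 * P)"
    using \<open>a \<noteq> 0\<close> by (simp only: mult_cancel_right of_real_eq_iff) simp
  then have "P * (4 * P - 1) = 0"
    by (simp add: algebra_simps power2_eq_square)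
  moreover have "P > 0"
    by (simp add: P_def)
  ultimately have "(1/2::real) powr p = (1/2) powr 2"
    by (simp add: P_def power2_eq_square)
  then show "p = 2"
    by (subst (asm) powr_inj) auto
qed

subsection \<open>Sections isometric to the two-dimensional space\<close>

text \<open>The span of \<open>u\<close> and \<open>v\<close> is a copy of the two-dimensional space \<open>l\<^sub>p\<close> onto which
  \<open>z \<mapsto> l z u + m z v\<close> is a projection of norm at most one.\<close>

locale lp_pair =
  fixes u v :: "'e::complex_banach" and l m :: "'e \<Rightarrow> complex" and p :: real
  assumes p: "1 \<le> p"
    and linear: "bounded_linear l" "\<And>c z. l (c *\<^sub>C z) = c * l z"
      "bounded_linear m" "\<And>c z. m (c *\<^sub>C z) = c * m z"
    and dual: "l u = 1" "l v = 0" "m u = 0" "m v = 1"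
    and norm_pair: "\<And>x y. norm (x *\<^sub>C u + y *\<^sub>C v) powr p = cmod x powr p + cmod y powr p"
    and contraction: "\<And>z. cmod (l z) powr p + cmod (m z) powr p \<le> norm z powr p"
begin

lemma powr_less_1: "0 \<le> a \<Longrightarrow> a powr p < 1 \<longleftrightarrow> a < (1::real)"
  using p powr_less_mono2[of p a 1] powr_mono2[of p 1 a] by (cases "a < 1") auto

lemma powr_le_1: "0 \<le> a \<Longrightarrow> a powr p \<le> 1 \<longleftrightarrow> a \<le> (1::real)"
proof (cases "a \<le> 1")
  case True
  then show "0 \<le> a \<Longrightarrow> ?thesis"
    using p powr_mono2[of p a 1] by simp
next
  case False
  then have "1 powr p < a powr p"
    using p by (intro powr_less_mono2) auto
  then show ?thesis
    using False by simp
qed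

lemma pair_in_ball: "x *\<^sub>C u + y *\<^sub>C v \<in> ball 0 1 \<longleftrightarrow> cmod x powr p + cmod y powr p < 1"
  by (simp flip: norm_pair add: powr_less_1)

lemma norm_basis: "norm u = 1" "norm v = 1"
proof -
  have eq: "a = 1" if "0 \<le> a" "a powr p = 1" for a
    using that powr_less_1[of a] powr_le_1[of a] by auto
  have "(1::complex) *\<^sub>C z = z" "(0::complex) *\<^sub>C z = 0" for z :: 'e
    using scaleC_of_real[of 1 z] scaleC_of_real[of 0 z] by simp_all
  then have "norm u powr p = 1" "norm v powr p = 1"
    using norm_pair[of 1 0] norm_pair[of 0 1] by simp_all
  then show "norm u = 1" "norm v = 1"
    using eq norm_ge_zero by blast+
qed

lemma functional_powr_le:
  assumes "z \<in> ball 0 1"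
  shows "cmod (l z) powr p + cmod (m z) powr p \<le> 1"
  using contraction[of z] assms powr_less_1[of "norm z"] by simp

lemma functional_le_1:
  assumes "z \<in> ball 0 1"
  shows "cmod (l z) \<le> 1" "cmod (m z) \<le> 1"
proof -
  have "cmod (l z) powr p \<le> 1" "cmod (m z) powr p \<le> 1"
    using functional_powr_le[OF assms] powr_ge_zero[of "cmod (l z)" p] powr_ge_zero[of "cmod (m z)" p]
    by linarith+
  then show "cmod (l z) \<le> 1" "cmod (m z) \<le> 1"
    by (simp_all add: powr_le_1)
qed

lemma functionals_holomorphic:
  "complex_frechet_holomorphic_on l S" "complex_frechet_holomorphic_on m S"
  using complex_frechet_holomorphic_on_affine[of l 0] complex_frechet_holomorphic_on_affine[of m 0] linear
  by (auto simp: scaleC_complex_def)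

end

section \<open>Conjugated rotations and their slices\<close>

locale lp_pair_automorphism = lp_pair u v l m p
  for u v :: "'a::complex_banach" and l m p +
  fixes \<phi> \<psi> :: "'a \<Rightarrow> 'a"
  assumes \<phi>: "complex_frechet_holomorphic_on \<phi> (ball 0 1)" "\<phi> ` ball 0 1 \<subseteq> ball 0 1"
    and \<psi>: "complex_frechet_holomorphic_on \<psi> (ball 0 1)" "\<psi> ` ball 0 1 \<subseteq> ball 0 1"
    and inverse: "\<And>z. z \<in> ball 0 1 \<Longrightarrow> \<phi> (\<psi> z) = z"
begin

text \<open>For \<open>cmod c = 1\<close> this is a rotation about the origin, conjugated by the
  automorphism and restricted to the span of \<open>u\<close> and \<open>v\<close>.\<close>

definition rot :: "complex \<Rightarrow> complex \<Rightarrow> complex \<Rightarrow> 'a"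
  where "rot c x y = \<phi> (c *\<^sub>C \<psi> (x *\<^sub>C u + y *\<^sub>C v))"

text \<open>Both \<open>\<psi>\<close> and \<open>\<phi>\<close> are evaluated inside the ball.
  Values of \<open>c\<close> outside the unit disc are included because a complex derivative at
  \<open>c = 1\<close> needs a full neighbourhood.\<close>

definition admissible :: "complex \<Rightarrow> complex \<Rightarrow> complex \<Rightarrow> bool"
  where "admissible c x y \<longleftrightarrow> cmod x powr p + cmod y powr p < 1 \<and> c *\<^sub>C \<psi> (x *\<^sub>C u + y *\<^sub>C v) \<in> ball 0 1"

lemma rot_in_ball: "admissible c x y \<Longrightarrow> rot c x y \<in> ball 0 1"
  unfolding admissible_def rot_def using \<phi>(2) by blast

text \<open>Each variable moves the argument of \<open>\<phi>\<close> or of \<open>\<psi>\<close>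
  along a complex line, so the chain rule gives holomorphy in that variable with the other two
  fixed.\<close>

lemma rot_holomorphic:
  assumes f: "complex_frechet_holomorphic_on f (ball 0 1)"
  shows "(\<And>c. c \<in> S \<Longrightarrow> admissible c x y) \<Longrightarrow> (\<lambda>c. f (rot c x y)) holomorphic_on S"
    and "(\<And>x. x \<in> S \<Longrightarrow> admissible c x y) \<Longrightarrow> (\<lambda>x. f (rot c x y)) holomorphic_on S"
    and "(\<And>y. y \<in> S \<Longrightarrow> admissible c x y) \<Longrightarrow> (\<lambda>y. f (rot c x y)) holomorphic_on S"
proof -
  have f\<phi>: "complex_frechet_holomorphic_on (\<lambda>z. f (\<phi> z)) (ball 0 1)"
    by (rule complex_frechet_holomorphic_on_compose[OF \<phi>(1) f \<phi>(2)])
  have line: "complex_frechet_holomorphic_on (\<lambda>c. a + c *\<^sub>C b) S" for a b :: 'a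
    using complex_frechet_holomorphic_on_line[of a 1 b] by simp
  have smult: "complex_frechet_holomorphic_on (\<lambda>z. c *\<^sub>C z) T" for c and T :: "'a set"
    using complex_frechet_holomorphic_on_affine[OF bounded_linear_scaleC_right[of c], where a = 0]
    by (simp add: scaleC_scaleC mult.commute)
  { assume "\<And>c. c \<in> S \<Longrightarrow> admissible c x y"
    then have "complex_frechet_holomorphic_on (\<lambda>c. f (\<phi> (0 + c *\<^sub>C \<psi> (x *\<^sub>C u + y *\<^sub>C v)))) S"
      by (intro complex_frechet_holomorphic_on_compose[OF line f\<phi>]) (auto simp: admissible_def)
    then show "(\<lambda>c. f (rot c x y)) holomorphic_on S"
      using complex_frechet_holomorphic_on_imp_holomorphic_on unfolding rot_def by fastforce }
  have inner: "complex_frechet_holomorphic_on (\<lambda>t. f (\<phi> (c *\<^sub>C \<psi> (a + t *\<^sub>C b)))) S"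
    if "\<And>t. t \<in> S \<Longrightarrow> a + t *\<^sub>C b \<in> ball 0 1 \<and> c *\<^sub>C \<psi> (a + t *\<^sub>C b) \<in> ball 0 1" for a b
  proof -
    have "complex_frechet_holomorphic_on (\<lambda>t. \<psi> (a + t *\<^sub>C b)) S"
      using that by (intro complex_frechet_holomorphic_on_compose[OF line \<psi>(1)]) auto
    then have "complex_frechet_holomorphic_on (\<lambda>t. c *\<^sub>C \<psi> (a + t *\<^sub>C b)) S"
      by (rule complex_frechet_holomorphic_on_compose[OF _ smult]) (rule subset_UNIV)
    then show ?thesis
      using that by (intro complex_frechet_holomorphic_on_compose[OF _ f\<phi>]) auto
  qed
  { assume *: "\<And>y. y \<in> S \<Longrightarrow> admissible c x y"
    have "complex_frechet_holomorphic_on (\<lambda>y. f (\<phi> (c *\<^sub>C \<psi> (x *\<^sub>C u + y *\<^sub>C v)))) S"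
      using * pair_in_ball by (intro inner) (auto simp: admissible_def)
    then show "(\<lambda>y. f (rot c x y)) holomorphic_on S"
      unfolding rot_def by (rule complex_frechet_holomorphic_on_imp_holomorphic_on) }
  { assume *: "\<And>x. x \<in> S \<Longrightarrow> admissible c x y"
    have "complex_frechet_holomorphic_on (\<lambda>x. f (\<phi> (c *\<^sub>C \<psi> (y *\<^sub>C v + x *\<^sub>C u)))) S"
      using * pair_in_ball by (intro inner) (auto simp: admissible_def add.commute)
    then show "(\<lambda>x. f (rot c x y)) holomorphic_on S"
      unfolding rot_def add.commute[of "_ *\<^sub>C u"] by (rule complex_frechet_holomorphic_on_imp_holomorphic_on) }
qed

lemma admissible_if_cmod_le_1:
  assumes "cmod c \<le> 1" "cmod x powr p + cmod y powr p < 1"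
  shows "admissible c x y"
proof -
  have "\<psi> (x *\<^sub>C u + y *\<^sub>C v) \<in> ball 0 1"
    using \<psi>(2) assms(2) pair_in_ball by blast
  then have "norm (c *\<^sub>C \<psi> (x *\<^sub>C u + y *\<^sub>C v)) < 1"
    using mult_right_mono[OF assms(1), of "norm (\<psi> (x *\<^sub>C u + y *\<^sub>C v))"] by (simp add: norm_scaleC)
  then show ?thesis
    using assms(2) by (simp add: admissible_def)
qed

text \<open>Since \<open>\<psi> 0\<close> has norm below one, continuity keeps the norm of
  \<open>\<psi> z\<close> below some \<open>b < 1\<close> for small \<open>z\<close>. Then
  \<open>c\<close> may have any modulus below \<open>1 / b\<close>.\<close>

lemma admissible_neighbourhood:
  obtains R r where "1 < R" "0 < r" "r \<le> 1"
    "\<And>c x y. cmod c < R \<Longrightarrow> cmod x < r \<Longrightarrow> cmod y < r \<Longrightarrow> admissible c x y"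
proof -
  define b where "b = (1 + norm (\<psi> 0)) / 2"
  have "\<psi> 0 \<in> ball 0 1"
    using \<psi>(2) by (rule subsetD) simp
  then have "norm (\<psi> 0) < 1"
    by simp
  then have b: "norm (\<psi> 0) < b" "0 < b" "b < 1"
    unfolding b_def by (auto simp: field_simps intro: add_pos_nonneg)
  have "continuous (at 0) \<psi>"
    using complex_frechet_holomorphic_on_imp_continuous_on[OF \<psi>(1)]
    by (simp add: continuous_on_eq_continuous_at)
  then have "((\<lambda>z. norm (\<psi> z)) \<longlongrightarrow> norm (\<psi> 0)) (at 0)"
    by (intro tendsto_norm) (simp add: continuous_at)
  then have "\<forall>\<^sub>F z in at 0. norm (\<psi> z) < b"
    using b(1) by (rule order_tendstoD)
  then obtain d where d: "d > 0" "\<And>z. z \<noteq> 0 \<Longrightarrow> norm z < d \<Longrightarrow> norm (\<psi> z) < b"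
    by (auto simp: eventually_at)
  \<comment> \<open>Halved because the norm of \<open>x *\<^sub>C u + y *\<^sub>C v\<close> is only
    known to be below \<open>2 * r\<close>, which must not exceed \<open>1\<close> or
    \<open>d\<close>.\<close>
  define r where "r = min 1 d / 2"
  have r: "0 < r" "r \<le> 1" "2 * r \<le> 1" "2 * r \<le> d"
    using d(1) by (auto simp: r_def)
  have "admissible c x y" if *: "cmod c < 1 / b" "cmod x < r" "cmod y < r" for c x y
  proof -
    define z where "z = x *\<^sub>C u + y *\<^sub>C v"
    have "norm z \<le> cmod x + cmod y"
      unfolding z_def using norm_triangle_ineq[of "x *\<^sub>C u" "y *\<^sub>C v"] by (simp add: norm_scaleC norm_basis)
    then have z: "norm z < 2 * r"
      using * by simp
    then have "norm (\<psi> z) < b"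
      using d(2)[of z] b(1) r by (cases "z = 0") auto
    then have "norm (c *\<^sub>C \<psi> z) \<le> cmod c * b"
      by (simp add: norm_scaleC mult_left_mono)
    also have "\<dots> < 1"
      using *(1) b(2) by (simp add: field_simps)
    finally have "c *\<^sub>C \<psi> z \<in> ball 0 1" by simp
    moreover have "z \<in> ball 0 1"
      using z r by simp
    ultimately show ?thesis
      using pair_in_ball by (simp add: admissible_def z_def)
  qed
  moreover have "1 < 1 / b"
    using b by simp
  ultimately show ?thesis
    using r(1,2) by (intro that[of "1 / b" r]) auto
qed

lemma rot_1:
  assumes "cmod x powr p + cmod y powr p < 1"
  shows "l (rot 1 x y) = x" "m (rot 1 x y) = y"
proof -
  have "(1::complex) *\<^sub>C z = z" for z :: 'a
    using scaleC_of_real[of 1 z] by simp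
  then have "rot 1 x y = x *\<^sub>C u + y *\<^sub>C v"
    using inverse assms pair_in_ball by (simp add: rot_def)
  then show "l (rot 1 x y) = x" "m (rot 1 x y) = y"
    using linear dual by (simp_all add: linear_simps)
qed

text \<open>The only part of the second coordinate that survives the averaging over \<open>w\<close>
  described next.\<close>

definition cross :: "complex \<Rightarrow> complex \<Rightarrow> complex"
  where "cross c a = deriv (\<lambda>y. m (rot c a y)) 0"

text \<open>Averaging the support functional of \<open>(x \<zeta>, s \<zeta> w)\<close>, evaluated at the point
  \<open>rot c (x \<zeta>) (s \<zeta> w)\<close>, over the circle of all \<open>w\<close> leaves a function of \<open>\<zeta>\<close> bounded by one,
  where \<open>s powr p = 1 - x powr p\<close>.\<close>

definition slice :: "real \<Rightarrow> complex \<Rightarrow> complex \<Rightarrow> complex"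
  where "slice x c z = of_real (x powr (p - 1)) * l (rot c (z * of_real x) 0)
    + of_real (1 - x powr p) * z * cross c (z * of_real x)"

lemma open_section: "open {y. cmod a powr p + cmod y powr p < 1}"
  by (intro open_Collect_less continuous_on_add continuous_on_const continuous_on_powr'
      continuous_on_norm continuous_on_id) (use p in auto)

text \<open>The disc of admissible \<open>y\<close> shrinks as \<open>cmod a\<close> tends to one.
  The parameter lemma is therefore applied on each disc of radius \<open>R < 1\<close>, and these
  exhaust the unit disc.\<close>

lemma cross_holomorphic:
  assumes c: "cmod c \<le> 1"
  shows "cross c holomorphic_on ball 0 1"
proof -
  have *: "cross c holomorphic_on ball 0 R" if R: "0 < R" "R < 1" for R
  proof -
    have Rp: "R powr p < 1"
      using R powr_less_1 by simp
    \<comment> \<open>Chosen so that \<open>R powr p + r powr p = 1\<close>.\<close>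
    define r where "r = (1 - R powr p) powr (1 / p)"
    have r: "0 < r" "r powr p = 1 - R powr p"
      using Rp p by (auto simp: r_def powr_powr)
    have adm: "admissible c a y" if "a \<in> ball 0 R" "y \<in> ball 0 r" for a y
    proof (rule admissible_if_cmod_le_1[OF c])
      have "cmod a powr p < R powr p" "cmod y powr p < r powr p"
        using that p by (auto intro!: powr_less_mono2)
      then show "cmod a powr p + cmod y powr p < 1"
        using r(2) by linarith
    qed
    show ?thesis
      unfolding cross_def
    proof (rule holomorphic_deriv_parameter[OF open_ball r(1)])
      show "(\<lambda>y. m (rot c a y)) holomorphic_on ball 0 r" if "a \<in> ball 0 R" for a
        by (rule rot_holomorphic(3)[OF functionals_holomorphic(2)]) (rule adm[OF that])
      show "cmod (m (rot c a y)) \<le> 1" if "a \<in> ball 0 R" "y \<in> ball 0 r" for a y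
        using that by (intro functional_le_1 rot_in_ball adm)
      show "(\<lambda>a. m (rot c a y)) holomorphic_on ball 0 R" if "y \<in> ball 0 r" for y
        by (rule rot_holomorphic(2)[OF functionals_holomorphic(2)]) (rule adm[OF _ that])
    qed
  qed
  show ?thesis
    unfolding holomorphic_on_open[OF open_ball]
  proof
    fix a :: complex assume "a \<in> ball 0 1"
    define R where "R = (1 + cmod a) / 2"
    have "cmod a < 1"
      using \<open>a \<in> ball 0 1\<close> by simp
    then have R: "0 < R" "R < 1" "a \<in> ball 0 R"
      using norm_ge_zero[of a] unfolding R_def by (simp_all add: add_pos_nonneg)
    show "\<exists>f'. (cross c has_field_derivative f') (at a)"
      using *[OF R(1,2)] R(3) holomorphic_on_open[OF open_ball] by blast
  qed
qed

lemma slice_holomorphic: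
  assumes c: "cmod c \<le> 1" and x: "0 < x" "x \<le> 1"
  shows "slice x c holomorphic_on ball 0 1"
proof -
  have mem: "z * of_real x \<in> ball 0 1" if "z \<in> ball 0 1" for z :: complex
    using that x mult_left_mono[of x 1 "cmod z"] by (simp add: norm_mult)
  have f: "(\<lambda>a. l (rot c a 0)) holomorphic_on ball 0 1"
    by (intro rot_holomorphic(2) functionals_holomorphic admissible_if_cmod_le_1 c)
       (simp add: powr_less_1)
  have comp: "(\<lambda>z. g (z * of_real x)) holomorphic_on ball 0 1" if "g holomorphic_on ball 0 1" for g
  proof -
    have "(\<lambda>z. z * complex_of_real x) holomorphic_on ball 0 1"
      by (intro holomorphic_intros)
    moreover have "(\<lambda>z. z * complex_of_real x) ` ball 0 1 \<subseteq> ball 0 1"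
      using mem by blast
    ultimately show ?thesis
      using holomorphic_on_compose_gen[OF _ that] unfolding o_def by blast
  qed
  show ?thesis
    unfolding slice_def
    by (intro holomorphic_intros comp[OF f] comp[OF cross_holomorphic[OF c]])
qed

text \<open>The slice is the derivative at zero of a function \<open>k\<close> of \<open>w\<close>
  that is bounded by one on the unit circle, so Cauchy's inequality applies.\<close>

lemma cmod_slice_le_1:
  assumes c: "cmod c \<le> 1" and x: "0 < x" "x \<le> 1" and z: "z \<in> ball 0 1"
  shows "cmod (slice x c z) \<le> 1"
proof -
  \<comment> \<open>Completes \<open>x\<close> to a unit vector \<open>(x, s)\<close> of the
    two-dimensional space.\<close>
  define s where "s = (1 - x powr p) powr (1 / p)"
  have "x powr p \<le> 1"
    using x powr_le_1 by simp
  then have s: "0 \<le> s" "s powr p = 1 - x powr p"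
    using p by (auto simp: s_def powr_powr)
  define U where "U = {y. cmod (z * x) powr p + cmod y powr p < 1}"
  define f where "f y = l (rot c (z * x) y)" for y
  define g where "g y = m (rot c (z * x) y)" for y
  have adm: "admissible c (z * x) y" if "y \<in> U" for y
    using that by (intro admissible_if_cmod_le_1[OF c]) (simp add: U_def)
  have fg: "f holomorphic_on U" "g holomorphic_on U"
    unfolding f_def g_def by (intro rot_holomorphic(3) functionals_holomorphic adm; assumption)+
  have U: "w * (z * s) \<in> U" if "w \<in> cball 0 1" for w
  proof -
    have "cmod (w * (z * s)) powr p \<le> (cmod z * s) powr p"
      using that s p mult_right_mono[of "cmod w" 1 "cmod z * s"]
      by (intro powr_mono2) (auto simp: norm_mult)
    moreover have "(cmod z * s) powr p = cmod z powr p * s powr p"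
      "cmod (z * x) powr p = cmod z powr p * x powr p"
      using x s by (simp_all add: norm_mult powr_mult)
    ultimately have "cmod (z * x) powr p + cmod (w * (z * s)) powr p \<le> cmod z powr p * (x powr p + s powr p)"
      by (simp only: distrib_left)
    also have "\<dots> = cmod z powr p"
      using s by simp
    also have "\<dots> < 1"
      using z powr_less_1 by simp
    finally show ?thesis
      by (simp add: U_def)
  qed
  \<comment> \<open>The support functional carries the phase \<open>cnj w = 1 / w\<close> in its
    second coefficient. Multiplication by \<open>w\<close> makes the pairing holomorphic and turns
    its mean over the circle into the derivative at zero.\<close>
  define k where "k w = w * (of_real (x powr (p - 1)) * f (w * (z * s))) + of_real (s powr (p - 1)) * g (w * (z * s))" for w
  have comp: "(\<lambda>w. h (w * (z * s))) holomorphic_on cball 0 1" if "h holomorphic_on U" for h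
  proof -
    have "(\<lambda>w. w * (z * s)) holomorphic_on cball 0 1"
      by (intro holomorphic_intros)
    moreover have "(\<lambda>w. w * (z * s)) ` cball 0 1 \<subseteq> U"
      using U by blast
    ultimately show ?thesis
      using holomorphic_on_compose_gen[OF _ that] unfolding o_def by blast
  qed
  have k: "k holomorphic_on cball 0 1"
    unfolding k_def by (intro holomorphic_intros comp fg)
  have "cmod ((deriv ^^ 1) k 0) \<le> fact 1 * 1 / 1 ^ 1"
  proof (rule Cauchy_inequality)
    show "k holomorphic_on ball 0 1"
      using k by (rule holomorphic_on_subset) auto
    show "continuous_on (cball 0 1) k"
      using k by (rule holomorphic_on_imp_continuous_on)
    fix w :: complex assume "cmod (0 - w) = 1"
    then have w: "cmod w = 1" by simp
    then have "rot c (z * x) (w * (z * s)) \<in> ball 0 1"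
      by (intro rot_in_ball adm U) simp
    from functional_powr_le[OF this]
    have "x powr (p - 1) * cmod (f (w * (z * s))) + s powr (p - 1) * cmod (g (w * (z * s))) \<le> 1"
      using p x s by (intro powr_pair_le_1) (auto simp: f_def g_def)
    moreover have "cmod (k w) \<le> x powr (p - 1) * cmod (f (w * (z * s))) + s powr (p - 1) * cmod (g (w * (z * s)))"
      unfolding k_def using w by (intro order_trans[OF norm_triangle_ineq]) (simp add: norm_mult)
    ultimately show "cmod (k w) \<le> 1"
      by linarith
  qed simp
  moreover have "deriv k 0 = slice x c z"
  proof (rule DERIV_imp_deriv)
    have "open U"
      unfolding U_def by (rule open_section)
    have "0 \<in> U"
      using U[of 0] by simp
    have der: "((\<lambda>w. h (w * (z * s))) has_field_derivative deriv h 0 * (z * s)) (at 0)" if "h holomorphic_on U" for h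
    proof (rule DERIV_chain2[where g = "\<lambda>w. w * (z * s)" and f = h])
      show "(h has_field_derivative deriv h 0) (at (0 * (z * s)))"
        using that \<open>open U\<close> \<open>0 \<in> U\<close> by (simp add: holomorphic_derivI)
      show "((\<lambda>w. w * (z * s)) has_field_derivative z * s) (at 0)"
        by (auto intro!: derivative_eq_intros)
    qed
    \<comment> \<open>At \<open>w = 0\<close> the first summand contributes only the value of
      \<open>f\<close> and the second only the derivative of \<open>g\<close>.\<close>
    have "(k has_field_derivative (0 * (of_real (x powr (p - 1)) * (deriv f 0 * (z * s))) + 1 * (of_real (x powr (p - 1)) * f (0 * (z * s))))
        + of_real (s powr (p - 1)) * (deriv g 0 * (z * s))) (at 0)"
      unfolding k_def by (intro DERIV_add DERIV_mult' DERIV_ident DERIV_cmult der fg)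
    moreover have "(0 * (of_real (x powr (p - 1)) * (deriv f 0 * (z * s))) + 1 * (of_real (x powr (p - 1)) * f (0 * (z * s))))
        + of_real (s powr (p - 1)) * (deriv g 0 * (z * s)) = slice x c z"
    proof -
      have "of_real (s powr (p - 1)) * of_real s = (of_real (1 - x powr p) :: complex)"
        using s powr_mult_base[of s "p - 1"] by (simp add: mult.commute flip: of_real_mult)
      then have "of_real (s powr (p - 1)) * (deriv g 0 * (z * s)) = of_real (1 - x powr p) * z * deriv g 0"
        by (metis mult.assoc mult.commute)
      moreover have "deriv g 0 = cross c (z * x)"
        by (simp add: cross_def g_def [abs_def])
      ultimately show ?thesis
        by (simp only: slice_def f_def mult_zero_left mult_1_left add_0_left)
    qed
    ultimately show "(k has_field_derivative slice x c z) (at 0)"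
      by simp
  qed
  ultimately show ?thesis
    by simp
qed

text \<open>At \<open>c = 1\<close> the coordinates come back unchanged, so \<open>cross\<close> is
  one and the weights \<open>x powr p\<close> and \<open>1 - x powr p\<close> add up to one.\<close>

lemma slice_1:
  assumes x: "0 < x" "x \<le> 1" and z: "z \<in> ball 0 1"
  shows "slice x 1 z = z"
proof -
  have zx: "cmod (z * x) < 1"
    using z x mult_left_mono[of x 1 "cmod z"] by (simp add: norm_mult)
  define U where "U = {y. cmod (z * x) powr p + cmod y powr p < 1}"
  have "open U"
    unfolding U_def by (rule open_section)
  moreover have "0 \<in> U"
    using zx by (simp add: U_def powr_less_1)
  ultimately have "\<forall>\<^sub>F y in nhds 0. y \<in> U"
    by (rule eventually_nhds_in_open)
  then have "\<forall>\<^sub>F y in nhds 0. m (rot 1 (z * x) y) = y"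
    by eventually_elim (simp add: U_def rot_1)
  then have "cross 1 (z * x) = deriv (\<lambda>y. y) 0"
    unfolding cross_def by (rule deriv_cong_ev) simp
  moreover have "l (rot 1 (z * x) 0) = z * x"
    using zx by (intro rot_1) (simp add: powr_less_1)
  moreover have "of_real (x powr (p - 1)) * of_real x = (of_real (x powr p) :: complex)"
    using x powr_mult_base[of x "p - 1"] by (simp add: mult.commute flip: of_real_mult)
  ultimately show ?thesis
    by (simp add: slice_def algebra_simps)
qed

text \<open>The extremal lemma is applied to \<open>slice x\<close>. Its coefficients of order 0 and
  2 depend on \<open>x\<close> only through explicit factors, so \<open>q1\<close> and
  \<open>q2\<close> can be fixed before \<open>x\<close> is chosen.\<close>

lemma slice_coefficient_identity:
  obtains q1 q2 where "\<And>x. 0 < x \<Longrightarrow> x \<le> 1 \<Longrightarrow>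
      of_real (x powr (p - 1)) * of_real x ^ 2 * q1 + of_real (1 - x powr p) * of_real x * q2
        = of_real (x powr (p - 1)) * cnj (deriv (\<lambda>c. l (rot c 0 0)) 1)"
proof -
  obtain R r where Rr: "1 < R" "0 < r" "r \<le> 1"
    and adm: "\<And>c x y. cmod c < R \<Longrightarrow> cmod x < r \<Longrightarrow> cmod y < r \<Longrightarrow> admissible c x y"
    using admissible_neighbourhood by blast
  define f where "f c a = l (rot c a 0)" for c a
  define S where "S = ball (0::complex) R"
  have S: "open S" "1 \<in> S"
    using Rr by (auto simp: S_def)
  have adm': "admissible c a y" if "c \<in> S" "a \<in> ball 0 r" "y \<in> ball 0 r" for c a y
    using that by (intro adm) (auto simp: S_def)
  have zero: "0 \<in> ball (0::complex) r"
    using Rr by simp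
  note l = functionals_holomorphic(1)[of "ball 0 1"] and m = functionals_holomorphic(2)[of "ball 0 1"]
  have m_le: "cmod (m (rot c a y)) \<le> 1" if "c \<in> S" "a \<in> ball 0 r" "y \<in> ball 0 r" for c a y
    using that by (intro functional_le_1 rot_in_ball adm')
  have f_le: "cmod (f c a) \<le> 1" if "c \<in> S" "a \<in> ball 0 r" for c a
    unfolding f_def using that zero by (intro functional_le_1 rot_in_ball adm')
  have m3: "(\<lambda>y. m (rot c a y)) holomorphic_on ball 0 r" if "c \<in> S" "a \<in> ball 0 r" for c a
    by (rule rot_holomorphic(3)[OF m]) (rule adm'[OF that])
  have m2: "(\<lambda>a. m (rot c a y)) holomorphic_on ball 0 r" if "c \<in> S" "y \<in> ball 0 r" for c y
    by (rule rot_holomorphic(2)[OF m]) (rule adm'[OF that(1) _ that(2)])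
  have m1: "(\<lambda>c. m (rot c a y)) holomorphic_on S" if "a \<in> ball 0 r" "y \<in> ball 0 r" for a y
    by (rule rot_holomorphic(1)[OF m]) (rule adm'[OF _ that])
  have f2: "f c holomorphic_on ball 0 r" if "c \<in> S" for c
    unfolding f_def by (rule rot_holomorphic(2)[OF l]) (rule adm'[OF that _ zero])
  have f1: "(\<lambda>c. f c a) holomorphic_on S" if "a \<in> ball 0 r" for a
    unfolding f_def by (rule rot_holomorphic(1)[OF l]) (rule adm'[OF _ that zero])
  have cross2: "cross c holomorphic_on ball 0 r" if "c \<in> S" for c
    unfolding cross_def
    by (rule holomorphic_deriv_parameter[OF open_ball Rr(2) m3 m_le m2]) (use that in auto)
  have cross1: "(\<lambda>c. cross c a) holomorphic_on S" if "a \<in> ball 0 r" for a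
    unfolding cross_def
    by (rule holomorphic_deriv_parameter[OF S(1) Rr(2) m3 m_le m1]) (use that in auto)
  have cross_le: "cmod (cross c a) \<le> 4 * 1 / r" if "c \<in> S" "a \<in> ball 0 r" for c a
    unfolding cross_def
    by (rule cmod_deriv_le[OF m3[OF that] Rr(2) _ m_le[OF that]]) (use Rr in auto)
  define q1 where "q1 = deriv (\<lambda>c. (deriv ^^ 2) (f c) 0 / 2) 1"
  define q2 where "q2 = deriv (\<lambda>c. deriv (cross c) 0) 1"
  have q1: "((\<lambda>c. (deriv ^^ 2) (f c) 0 / 2) has_field_derivative q1) (at 1)"
    unfolding q1_def
    by (intro holomorphic_derivI[OF _ S] holomorphic_intros
        holomorphic_higher_deriv_parameter[OF S(1) Rr(2) f2 f_le f1]) auto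
  have q2: "((\<lambda>c. deriv (cross c) 0) has_field_derivative q2) (at 1)"
    unfolding q2_def
    by (intro holomorphic_derivI[OF _ S]
        holomorphic_deriv_parameter[OF S(1) Rr(2) cross2 cross_le cross1])
  show ?thesis
  proof (rule that[of q1 q2])
    fix x :: real assume x: "0 < x" "x \<le> 1"
    have mem: "z * of_real x \<in> ball 0 r" if "z \<in> ball 0 r" for z :: complex
      using that x mult_left_mono[of x 1 "cmod z"] by (simp add: norm_mult)
    have comp: "(\<lambda>z. g (z * complex_of_real x)) holomorphic_on ball 0 r" if "g holomorphic_on ball 0 r" for g
    proof -
      have "(\<lambda>z. z * complex_of_real x) holomorphic_on ball 0 r"
        by (intro holomorphic_intros)
      moreover have "(\<lambda>z. z * complex_of_real x) ` ball 0 r \<subseteq> ball 0 r"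
        using mem by blast
      ultimately show ?thesis
        using holomorphic_on_compose_gen[OF _ that] unfolding o_def by blast
    qed
    have slice: "slice x c = (\<lambda>z. of_real (x powr (p - 1)) * f c (z * of_real x)
        + of_real (1 - x powr p) * z * cross c (z * of_real x))" for c
      by (simp add: slice_def f_def fun_eq_iff)
    have xp: "x powr (p - 1) \<le> 1" "x powr p \<le> 1" "0 \<le> x powr p"
      using x p powr_mono2[of "p - 1" x 1] powr_le_1 by auto
    have "deriv (\<lambda>c. (deriv ^^ 2) (slice x c) 0 / 2) 1 = cnj (deriv (\<lambda>c. slice x c 0) 1)"
    proof (rule disc_family_coefficient_derivatives[OF S Rr(2), where C = "1 + 4"])
      show "slice x c holomorphic_on ball 0 r" if "c \<in> S" for c
        unfolding slice by (intro holomorphic_intros comp f2 cross2 that)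
      show "(\<lambda>c. slice x c z) holomorphic_on S" if "z \<in> ball 0 r" for z
        unfolding slice by (intro holomorphic_intros f1 cross1 mem that)
      \<comment> \<open>The first summand is at most \<open>1\<close>. In the second the factor
        \<open>z\<close> contributes \<open>r\<close>, which cancels the \<open>r\<close> in the
        Cauchy bound \<open>4 * 1 / r\<close> for \<open>cross\<close>.\<close>
      show "cmod (slice x c z) \<le> 1 + 4" if "c \<in> S" "z \<in> ball 0 r" for c z
      proof -
        have "cmod (of_real (x powr (p - 1)) * f c (z * of_real x)) \<le> 1 * 1"
          unfolding norm_mult using xp f_le[OF that(1) mem[OF that(2)]] by (intro mult_mono) auto
        moreover have "cmod (of_real (1 - x powr p) * z * cross c (z * of_real x)) \<le> 1 * r * (4 * 1 / r)"
          unfolding norm_mult norm_of_real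
          using xp Rr that(2) cross_le[OF that(1) mem[OF that(2)]] by (intro mult_mono) auto
        ultimately show ?thesis
          unfolding slice using Rr by (intro order_trans[OF norm_triangle_ineq]) simp
      qed
    qed (use slice_holomorphic cmod_slice_le_1 slice_1 x in auto)
    moreover have "((\<lambda>c. (deriv ^^ 2) (slice x c) 0 / 2) has_field_derivative
        of_real (x powr (p - 1)) * of_real x ^ 2 * q1 + of_real (1 - x powr p) * of_real x * q2) (at 1)"
    proof (rule has_field_derivative_transform_within_open[OF _ S])
      show "((\<lambda>c. of_real (x powr (p - 1)) * of_real x ^ 2 * ((deriv ^^ 2) (f c) 0 / 2)
          + of_real (1 - x powr p) * of_real x * deriv (cross c) 0) has_field_derivative
        of_real (x powr (p - 1)) * of_real x ^ 2 * q1 + of_real (1 - x powr p) * of_real x * q2) (at 1)"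
        by (intro DERIV_add DERIV_cmult q1 q2)
      show "of_real (x powr (p - 1)) * of_real x ^ 2 * ((deriv ^^ 2) (f c) 0 / 2)
          + of_real (1 - x powr p) * of_real x * deriv (cross c) 0 = (deriv ^^ 2) (slice x c) 0 / 2"
        if "c \<in> S" for c
        unfolding slice
        by (subst second_derivative_combination[OF f2[OF that] cross2[OF that] Rr(2)]) (use x in \<open>auto simp: field_simps\<close>)
    qed
    moreover have "deriv (\<lambda>c. slice x c 0) 1 = of_real (x powr (p - 1)) * deriv (\<lambda>c. l (rot c 0 0)) 1"
    proof -
      have "((\<lambda>c. f c 0) has_field_derivative deriv (\<lambda>c. f c 0) 1) (at 1)"
        by (intro holomorphic_derivI[OF _ S] f1 zero)
      from DERIV_imp_deriv[OF DERIV_cmult[OF this]] show ?thesis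
        by (simp add: slice f_def)
    qed
    ultimately show "of_real (x powr (p - 1)) * of_real x ^ 2 * q1 + of_real (1 - x powr p) * of_real x * q2
        = of_real (x powr (p - 1)) * cnj (deriv (\<lambda>c. l (rot c 0 0)) 1)"
      by (simp add: DERIV_imp_deriv)
  qed
qed

text \<open>The coefficient identity holds for all \<open>x\<close> in the half-open unit interval,
  so for \<open>p \<noteq> 2\<close> the derivative of
  \<open>l (\<phi> (c *\<^sub>C \<psi> 0))\<close> at \<open>c = 1\<close> vanishes. The chain rule
  identifies this derivative.\<close>

lemma functional_of_generator:
  assumes "p \<noteq> 2" and D: "(\<phi> has_derivative D) (at (\<psi> 0))" "\<And>c z. D (c *\<^sub>C z) = c *\<^sub>C D z"
  shows "l (D (\<psi> 0)) = 0"
proof -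
  have "cnj (deriv (\<lambda>c. l (rot c 0 0)) 1) = 0"
    using slice_coefficient_identity exponent_eq_2 assms(1) by metis
  moreover have "deriv (\<lambda>c. l (rot c 0 0)) 1 = l (D (\<psi> 0))"
  proof (rule DERIV_imp_deriv)
    have one: "(1::complex) *\<^sub>C z = z" "(0::complex) *\<^sub>C z = 0" for z :: 'a
      using scaleC_of_real[of 1 z] scaleC_of_real[of 0 z] by simp_all
    have s: "((\<lambda>c. c *\<^sub>C \<psi> 0) has_derivative (\<lambda>c. c *\<^sub>C \<psi> 0)) (at 1)"
      by (rule bounded_linear_imp_has_derivative[OF bounded_linear_scaleC_left])
    have "(\<phi> has_derivative D) (at ((1::complex) *\<^sub>C \<psi> 0))"
      using D(1) one by simp
    from has_derivative_compose[OF s this]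
    have "((\<lambda>c. \<phi> (c *\<^sub>C \<psi> 0)) has_derivative (\<lambda>c. D (c *\<^sub>C \<psi> 0))) (at 1)" .
    then have "((\<lambda>c. l (\<phi> (c *\<^sub>C \<psi> 0))) has_derivative (\<lambda>c. l (D (c *\<^sub>C \<psi> 0)))) (at 1)"
      by (rule bounded_linear.has_derivative[OF linear(1)])
    moreover have "(\<lambda>c. l (D (c *\<^sub>C \<psi> 0))) = (*) (l (D (\<psi> 0)))"
      by (simp add: D(2) linear(2) fun_eq_iff mult.commute)
    ultimately show "((\<lambda>c. l (rot c 0 0)) has_field_derivative l (D (\<psi> 0))) (at 1)"
      by (simp add: has_field_derivative_def rot_def one)
  qed
  ultimately show ?thesis
    by simp
qed

end

subsection \<open>Indicator functions and means in the Lebesgue space\<close>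

locale Lp_space = finite_measure M for M :: "'w measure" +
  fixes p :: real and T :: "('w \<Rightarrow> complex) \<Rightarrow> 'e::complex_banach"
  assumes p: "1 \<le> p" and Lp: "is_Lp_space M p T"
begin

abbreviation "L \<equiv> Lp_functions M p"

lemma T_add: "f \<in> L \<Longrightarrow> g \<in> L \<Longrightarrow> T (\<lambda>w. f w + g w) = T f + T g"
  and T_scale: "f \<in> L \<Longrightarrow> T (\<lambda>w. c * f w) = c *\<^sub>C T f"
  and norm_T: "f \<in> L \<Longrightarrow> norm (T f) = Lp_norm M p f"
  and T_surj: "T ` L = UNIV"
  using Lp unfolding is_Lp_space_def by blast+

lemma measurable_L [measurable_dest]: "f \<in> L \<Longrightarrow> f \<in> borel_measurable M"
  by (simp add: Lp_functions_def)

lemma integrable_powr: "f \<in> L \<Longrightarrow> integrable M (\<lambda>w. cmod (f w) powr p)"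
  by (simp add: Lp_functions_def)

lemma bounded_in_L:
  assumes [measurable]: "f \<in> borel_measurable M" and "\<And>w. cmod (f w) \<le> B"
  shows "f \<in> L"
proof -
  have "integrable M (\<lambda>w. cmod (f w) powr p)"
  proof (rule integrable_const_bound[of _ "B powr p"])
    show "AE w in M. norm (cmod (f w) powr p) \<le> B powr p"
      using assms(2) p by (intro AE_I2) (auto intro!: powr_mono2)
  qed simp
  then show ?thesis
    by (simp add: Lp_functions_def)
qed

lemma L_scale: "f \<in> L \<Longrightarrow> (\<lambda>w. c * f w) \<in> L"
  unfolding Lp_functions_def by (auto simp: norm_mult powr_mult)

lemma L_add:
  assumes "f \<in> L" "g \<in> L"
  shows "(\<lambda>w. f w + g w) \<in> L"
  using Lp_functions_diff[OF assms(1) L_scale[OF assms(2), of "-1"] p] by simp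

text \<open>The function \<open>1 + cmod (f w) powr p\<close> is a majorant, integrable because the
  measure is finite.\<close>

lemma integrable_L:
  assumes "f \<in> L"
  shows "integrable M f"
proof (rule Bochner_Integration.integrable_bound)
  show "integrable M (\<lambda>w. 1 + cmod (f w) powr p)"
    using integrable_powr[OF assms] by simp
  show "AE w in M. norm (f w) \<le> norm (1 + cmod (f w) powr p)"
  proof (rule AE_I2)
    fix w
    show "norm (f w) \<le> norm (1 + cmod (f w) powr p)"
    proof (cases "cmod (f w) \<le> 1")
      case True
      then show ?thesis
        unfolding real_norm_def using powr_ge_zero[of "cmod (f w)" p] by linarith
    next
      case False
      then have "cmod (f w) powr 1 \<le> cmod (f w) powr p"
        using p by (intro powr_mono) auto
      then show ?thesis
        using False by simp
    qed
  qed
qed (use assms in measurable)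

lemma set_integrable_L:
  "f \<in> L \<Longrightarrow> A \<in> sets M \<Longrightarrow> set_integrable M A f"
  "f \<in> L \<Longrightarrow> A \<in> sets M \<Longrightarrow> set_integrable M A (\<lambda>w. cmod (f w) powr p)"
  unfolding set_integrable_def
  by (intro integrable_mult_indicator integrable_L integrable_powr; assumption)+

text \<open>Elements of the space are classes; fixing a representative allows integrals to be
  formed, and they do not depend on the choice.\<close>

definition rep :: "'e \<Rightarrow> 'w \<Rightarrow> complex"
  where "rep = inv_into L T"

lemma rep: "rep z \<in> L" "T (rep z) = z"
  unfolding rep_def using T_surj by (simp_all add: inv_into_into f_inv_into_f)

lemma T_eq_iff: "f \<in> L \<Longrightarrow> g \<in> L \<Longrightarrow> T f = T g \<longleftrightarrow> (AE w in M. f w = g w)"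
  by (rule is_Lp_space_eq_iff[OF Lp p])

lemma AE_rep_T: "f \<in> L \<Longrightarrow> AE w in M. rep (T f) w = f w"
  using T_eq_iff[of "rep (T f)" f] rep by simp

text \<open>If \<open>A\<close> has positive measure, this is
  \<open>measure M A powr (1 / p)\<close> times the mean over \<open>A\<close>; the factor makes the
  value on the normalised indicator \<open>bump A\<close> equal to one.\<close>

definition mean_functional :: "'w set \<Rightarrow> 'e \<Rightarrow> complex"
  where "mean_functional A z = of_real (measure M A powr (1 / p - 1)) * (LINT w:A|M. rep z w)"

definition bump :: "'w set \<Rightarrow> 'w \<Rightarrow> complex"
  where "bump A w = of_real (measure M A powr (- (1 / p))) * indicator A w"

lemma mean_functional_T:
  assumes "f \<in> L" "A \<in> sets M"
  shows "mean_functional A (T f) = of_real (measure M A powr (1 / p - 1)) * (LINT w:A|M. f w)"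
proof -
  have "(LINT w:A|M. rep (T f) w) = (LINT w:A|M. f w)"
    unfolding set_lebesgue_integral_def
  proof (rule integral_cong_AE)
    show "AE w in M. indicat_real A w *\<^sub>R rep (T f) w = indicat_real A w *\<^sub>R f w"
      using AE_rep_T[OF assms(1)] by eventually_elim simp
  qed (use assms rep in measurable)
  then show ?thesis
    by (simp add: mean_functional_def)
qed

lemma mean_functional_add:
  assumes "A \<in> sets M"
  shows "mean_functional A (x + y) = mean_functional A x + mean_functional A y"
proof -
  have "x + y = T (\<lambda>w. rep x w + rep y w)"
    using T_add rep by simp
  then have "mean_functional A (x + y) =
      of_real (measure M A powr (1 / p - 1)) * (LINT w:A|M. rep x w + rep y w)"
    using mean_functional_T[OF L_add assms] rep by simp
  then show ?thesis
    using rep assms by (simp add: mean_functional_def set_integral_add set_integrable_L distrib_left)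
qed

lemma mean_functional_scale:
  assumes "A \<in> sets M"
  shows "mean_functional A (c *\<^sub>C x) = c * mean_functional A x"
proof -
  have "c *\<^sub>C x = T (\<lambda>w. c * rep x w)"
    using T_scale rep by simp
  then have "mean_functional A (c *\<^sub>C x) =
      of_real (measure M A powr (1 / p - 1)) * (LINT w:A|M. c * rep x w)"
    using mean_functional_T[OF L_scale assms] rep by simp
  then show ?thesis
    by (simp add: mean_functional_def)
qed

lemma norm_powr: "f \<in> L \<Longrightarrow> norm (T f) powr p = (LINT w|M. cmod (f w) powr p)"
  using p by (simp add: norm_T Lp_norm_def powr_powr integral_nonneg_AE)

text \<open>Jensen's inequality for the power \<open>p\<close>, obtained by integrating Young's
  inequality over \<open>A\<close> with \<open>c\<close> the mean of
  \<open>cmod (rep z w)\<close>.\<close>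

lemma mean_functional_powr_le:
  assumes A: "A \<in> sets M" "0 < measure M A"
  shows "cmod (mean_functional A z) powr p \<le> (LINT w:A|M. cmod (rep z w) powr p)"
proof -
  define \<mu> where "\<mu> = measure M A"
  define J where "J = (LINT w:A|M. cmod (rep z w))"
  define c where "c = J / \<mu>"
  have \<mu>: "0 < \<mu>" using A by (simp add: \<mu>_def)
  have i1: "set_integrable M A (\<lambda>w. cmod (rep z w))"
    using set_integrable_norm[OF set_integrable_L(1)[OF rep(1) A(1)]] .
  have i2: "set_integrable M A (\<lambda>w. cmod (rep z w) powr p)"
    by (rule set_integrable_L(2)[OF rep(1) A(1)])
  have i3: "set_integrable M A (\<lambda>w. (p - 1) * c powr p)"
    unfolding set_integrable_def by (rule integrable_mult_indicator[OF A(1) integrable_const])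
  have J: "0 \<le> J"
    unfolding J_def set_lebesgue_integral_def by (intro integral_nonneg_AE AE_I2) simp
  then have c: "0 \<le> c"
    using \<mu> by (simp add: c_def)
  have "(LINT w:A|M. p * c powr (p - 1) * cmod (rep z w)) \<le> (LINT w:A|M. (p - 1) * c powr p + cmod (rep z w) powr p)"
    using i1 i2 i3 Young_powr[OF p c] by (intro set_integral_mono) (auto simp: mult.assoc)
  then have "p * c powr (p - 1) * J \<le> (p - 1) * c powr p * \<mu> + (LINT w:A|M. cmod (rep z w) powr p)"
    using i2 i3 A by (simp add: set_integral_add J_def \<mu>_def mult_ac set_integral_const)
  \<comment> \<open>By the choice of \<open>c\<close>, \<open>J = c * \<mu>\<close>; the two sides
    of the integrated inequality then differ by exactly one copy of
    \<open>c powr p * \<mu>\<close>.\<close>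
  moreover have "c powr (p - 1) * J = c powr p * \<mu>"
    using powr_mult_base[OF c, of "p - 1"] \<mu> by (simp add: c_def field_simps)
  ultimately have "p * (c powr p * \<mu>) \<le> (p - 1) * (c powr p * \<mu>) + (LINT w:A|M. cmod (rep z w) powr p)"
    by (simp only: mult.assoc)
  then have "c powr p * \<mu> \<le> (LINT w:A|M. cmod (rep z w) powr p)"
    by (simp add: left_diff_distrib)
  moreover have "cmod (mean_functional A z) powr p \<le> c powr p * \<mu>"
  proof -
    have "cmod (LINT w:A|M. rep z w) \<le> J"
      unfolding J_def by (rule set_integral_norm_bound[OF set_integrable_L(1)[OF rep(1) A(1)]])
    then have "cmod (mean_functional A z) \<le> \<mu> powr (1 / p - 1) * J"
      unfolding mean_functional_def norm_mult norm_of_real \<mu>_def by (simp add: mult_left_mono)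
    also have "\<dots> = \<mu> powr (1 / p) * c"
      using \<mu> by (simp add: c_def powr_diff)
    finally have "cmod (mean_functional A z) powr p \<le> (\<mu> powr (1 / p) * c) powr p"
      using p by (intro powr_mono2) auto
    also have "\<dots> = c powr p * \<mu>"
      using \<mu> c p by (simp add: powr_mult powr_powr)
    finally show ?thesis .
  qed
  ultimately show ?thesis
    by linarith
qed

lemma bump_in_L:
  assumes [measurable]: "A \<in> sets M"
  shows "bump A \<in> L"
proof (rule bounded_in_L)
  show "bump A \<in> borel_measurable M"
    unfolding bump_def [abs_def] by measurable
  show "cmod (bump A w) \<le> measure M A powr (- (1 / p))" for w
    by (simp add: bump_def norm_mult indicator_def)
qed

lemma mean_functional_bump:
  assumes "A \<in> sets M" "0 < measure M A"
  shows "mean_functional A (T (bump A)) = 1"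
proof -
  have "(LINT w:A|M. bump A w) = (LINT w:A|M. of_real (measure M A powr (- (1 / p))))"
    using assms by (intro set_lebesgue_integral_cong) (auto simp: bump_def)
  also have "\<dots> = of_real (measure M A * measure M A powr (- (1 / p)))"
    using assms by (simp add: scaleR_conv_of_real set_integral_const)
  finally have "mean_functional A (T (bump A))
      = of_real (measure M A powr (1 / p - 1) * (measure M A * measure M A powr (- (1 / p))))"
    using assms by (simp add: mean_functional_T bump_in_L)
  moreover have "measure M A powr (1 / p - 1) * (measure M A * measure M A powr (- (1 / p))) = 1"
  proof -
    have "a powr (q - 1) * (a * a powr (- q)) = 1" if "0 < a" for a q :: real
      using that powr_gt_zero[of a q] by (simp add: powr_diff powr_minus)
    then show ?thesis
      using assms by blast
  qed
  ultimately show ?thesis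
    by (simp only: of_real_1)
qed

lemma mean_functional_bump_disjoint:
  assumes "A \<in> sets M" "B \<in> sets M" "A \<inter> B = {}"
  shows "mean_functional A (T (bump B)) = 0"
proof -
  have "(LINT w:A|M. bump B w) = (LINT w:A|M. 0)"
    using assms by (intro set_lebesgue_integral_cong) (auto simp: bump_def indicator_def)
  then show ?thesis
    using assms by (simp add: mean_functional_T bump_in_L)
qed

text \<open>At each point at most one of the two indicators is non-zero, so the \<open>p\<close>-th
  power splits pointwise.\<close>

lemma norm_bump_pair:
  assumes A: "A \<in> sets M" "0 < measure M A" and B: "B \<in> sets M" "0 < measure M B" and "A \<inter> B = {}"
  shows "norm (x *\<^sub>C T (bump A) + y *\<^sub>C T (bump B)) powr p = cmod x powr p + cmod y powr p"
proof -
  have "x *\<^sub>C T (bump A) + y *\<^sub>C T (bump B) = T (\<lambda>w. x * bump A w + y * bump B w)"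
    using A B by (simp add: T_add T_scale L_scale bump_in_L)
  then have "norm (x *\<^sub>C T (bump A) + y *\<^sub>C T (bump B)) powr p
      = (LINT w|M. cmod (x * bump A w + y * bump B w) powr p)"
    using A B by (simp add: norm_powr L_add L_scale bump_in_L)
  also have "\<dots> = (LINT w|M. cmod x powr p / measure M A * indicator A w + cmod y powr p / measure M B * indicator B w)"
  proof (rule Bochner_Integration.integral_cong[OF refl])
    fix w
    have *: "(c * \<mu> powr (- (1 / p))) powr p = c powr p / \<mu>" if "0 \<le> c" "0 < \<mu>" for c \<mu> :: real
    proof -
      have "(\<mu> powr (- (1 / p))) powr p = 1 / \<mu>"
        using that p by (simp add: powr_powr powr_neg_one)
      then show ?thesis
        using that by (simp add: powr_mult)
    qed
    show "cmod (x * bump A w + y * bump B w) powr p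
        = cmod x powr p / measure M A * indicator A w + cmod y powr p / measure M B * indicator B w"
      using assms p by (cases "w \<in> A"; cases "w \<in> B") (auto simp: bump_def norm_mult *)
  qed
  also have "\<dots> = cmod x powr p + cmod y powr p"
    using A B by (subst Bochner_Integration.integral_add) (auto simp: integrable_real_mult_indicator less_top[symmetric] emeasure_finite)
  finally show ?thesis .
qed

text \<open>The contraction property adds the two mean inequalities; the integrals over the disjoint
  sets together are at most the integral over the whole space.\<close>

lemma lp_pair_bump:
  assumes A: "A \<in> sets M" "0 < measure M A" and B: "B \<in> sets M" "0 < measure M B" and disj: "A \<inter> B = {}"
  shows "lp_pair (T (bump A)) (T (bump B)) (mean_functional A) (mean_functional B) p"
proof -
  have contr: "cmod (mean_functional A z) powr p + cmod (mean_functional B z) powr p \<le> norm z powr p" for z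
  proof -
    have "cmod (mean_functional A z) powr p + cmod (mean_functional B z) powr p
        \<le> (LINT w:A|M. cmod (rep z w) powr p) + (LINT w:B|M. cmod (rep z w) powr p)"
      using mean_functional_powr_le A B by (intro add_mono)
    also have "\<dots> = (LINT w:A \<union> B|M. cmod (rep z w) powr p)"
      using A B disj rep by (intro set_integral_Un[symmetric] set_integrable_L)
    also have "\<dots> \<le> (LINT w|M. cmod (rep z w) powr p)"
      unfolding set_lebesgue_integral_def
      using A B rep integrable_powr by (intro integral_mono integrable_mult_indicator) (auto simp: indicator_def)
    also have "\<dots> = norm z powr p"
      using norm_powr[OF rep(1)] rep(2) by simp
    finally show ?thesis .
  qed
  have le: "cmod (mean_functional C z) \<le> norm z" if "C = A \<or> C = B" for C z
  proof (rule ccontr)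
    assume "\<not> ?thesis"
    then have "norm z powr p < cmod (mean_functional C z) powr p"
      using p by (intro powr_less_mono2) auto
    moreover have "cmod (mean_functional C z) powr p \<le> norm z powr p"
      using that
    proof (elim disjE; hypsubst)
      show "cmod (mean_functional A z) powr p \<le> norm z powr p"
        using contr[of z] powr_ge_zero[of "cmod (mean_functional B z)" p] by linarith
      show "cmod (mean_functional B z) powr p \<le> norm z powr p"
        using contr[of z] powr_ge_zero[of "cmod (mean_functional A z)" p] by linarith
    qed
    ultimately show False by simp
  qed
  have bl: "bounded_linear (mean_functional C)" if "C = A \<or> C = B" for C
  proof (rule bounded_linear_intro[where K = 1])
    have C: "C \<in> sets M" using that A B by auto
    show "mean_functional C (x + y) = mean_functional C x + mean_functional C y" for x y
      by (rule mean_functional_add[OF C])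
    show "mean_functional C (r *\<^sub>R x) = r *\<^sub>R mean_functional C x" for r x
      using mean_functional_scale[OF C, of "of_real r" x] by (simp add: scaleC_of_real scaleR_conv_of_real)
    show "cmod (mean_functional C x) \<le> norm x * 1" for x
      using le[OF that] by simp
  qed
  have disj': "B \<inter> A = {}"
    using disj by blast
  show ?thesis
  proof (rule lp_pair.intro)
    show "bounded_linear (mean_functional A)" "bounded_linear (mean_functional B)"
      by (rule bl, simp)+
    show "mean_functional A (c *\<^sub>C z) = c * mean_functional A z"
      "mean_functional B (c *\<^sub>C z) = c * mean_functional B z" for c z
      by (rule mean_functional_scale[OF A(1)], rule mean_functional_scale[OF B(1)])
    show "mean_functional A (T (bump A)) = 1" "mean_functional B (T (bump B)) = 1"
      by (rule mean_functional_bump[OF A], rule mean_functional_bump[OF B])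
    show "mean_functional A (T (bump B)) = 0" "mean_functional B (T (bump A)) = 0"
      by (rule mean_functional_bump_disjoint[OF A(1) B(1) disj],
          rule mean_functional_bump_disjoint[OF B(1) A(1) disj'])
    show "norm (x *\<^sub>C T (bump A) + y *\<^sub>C T (bump B)) powr p = cmod x powr p + cmod y powr p" for x y
      by (rule norm_bump_pair[OF A B disj])
  qed (rule p contr)+
qed

end

section \<open>Automorphisms of the ball fix the origin\<close>

lemma Aut_ballD:
  fixes \<phi> :: "'a::complex_banach \<Rightarrow> 'a"
  assumes "\<phi> \<in> Aut_ball"
  defines "\<psi> \<equiv> inv_into (ball 0 1) \<phi>"
  shows "complex_frechet_holomorphic_on \<phi> (ball 0 1)" "\<phi> ` ball 0 1 \<subseteq> ball 0 1"
    and "complex_frechet_holomorphic_on \<psi> (ball 0 1)" "\<psi> ` ball 0 1 \<subseteq> ball 0 1"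
    and "\<And>z. z \<in> ball 0 1 \<Longrightarrow> \<phi> (\<psi> z) = z" "\<And>z. z \<in> ball 0 1 \<Longrightarrow> \<psi> (\<phi> z) = z"
proof -
  have b: "bij_betw \<phi> (ball 0 1) (ball 0 1)"
    using assms by (simp add: Aut_ball_def)
  then have "bij_betw \<psi> (ball 0 1) (ball 0 1)"
    unfolding \<psi>_def by (rule bij_betw_inv_into)
  then show "\<psi> ` ball 0 1 \<subseteq> ball 0 1" "\<phi> ` ball 0 1 \<subseteq> ball 0 1"
    using b by (auto simp: bij_betw_def)
  show "\<phi> (\<psi> z) = z" "\<psi> (\<phi> z) = z" if "z \<in> ball 0 1" for z
    unfolding \<psi>_def using b that by (simp_all add: bij_betw_inv_into_right bij_betw_inv_into_left)
qed (use assms in \<open>simp_all add: Aut_ball_def\<close>)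

context Lp_space
begin

lemma eq_zero_if_set_integrals_eq_0:
  assumes "f \<in> L" "\<And>A. A \<in> sets M \<Longrightarrow> (LINT w:A|M. f w) = 0"
  shows "T f = 0"
proof -
  have "AE w in M. f w = 0"
    by (rule density_zero[OF integrable_L[OF assms(1)] assms(2)])
  moreover have zero: "(\<lambda>w. 0) \<in> L"
    by (rule bounded_in_L[of _ 0]) simp_all
  ultimately have "T f = T (\<lambda>w. 0)"
    by (simp add: T_eq_iff[OF assms(1) zero])
  moreover have "norm (T (\<lambda>w. 0)) = 0"
    using norm_T[OF zero] p by (simp add: Lp_norm_def)
  ultimately show ?thesis
    by simp
qed

lemma set_integral_null:
  fixes f :: "'w \<Rightarrow> complex"
  assumes "A \<in> sets M" "measure M A = 0"
  shows "(LINT w:A|M. f w) = 0"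
proof -
  have "A \<in> null_sets M"
    using assms by (intro null_setsI) (simp_all add: emeasure_eq_measure)
  then have "AE w in M. indicat_real A w *\<^sub>R f w = 0"
    by (rule AE_not_in[THEN AE_mp]) auto
  then show ?thesis
    unfolding set_lebesgue_integral_def by (rule integral_eq_zero_AE)
qed

lemma set_integral_split:
  assumes "f \<in> L" "A \<in> sets M"
  shows "(LINT w|M. f w) = (LINT w:A|M. f w) + (LINT w:space M - A|M. f w)"
proof -
  have "(LINT w:A \<union> (space M - A)|M. f w) = (LINT w:A|M. f w) + (LINT w:space M - A|M. f w)"
    using assms by (intro set_integral_Un set_integrable_L) auto
  moreover have "A \<union> (space M - A) = space M"
    using sets.sets_into_space[OF assms(2)] by blast
  ultimately show ?thesis
    using set_integral_space[OF integrable_L[OF assms(1)]] by simp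
qed

text \<open>If every measurable set or its complement were null, subtracting its mean from a
  function would make all set integrals vanish. All functions would be constant almost everywhere
  and the class of \<open>1\<close> would span the space.\<close>

lemma nontrivial_set:
  assumes "\<nexists>u::'e. \<forall>v. \<exists>c. v = c *\<^sub>C u"
  obtains A where "A \<in> sets M" "0 < measure M A" "0 < measure M (space M - A)"
proof -
  have "\<exists>A\<in>sets M. measure M A \<noteq> 0 \<and> measure M (space M - A) \<noteq> 0"
  proof (rule ccontr)
    assume "\<not> ?thesis"
    then have triv: "measure M A = 0 \<or> measure M (space M - A) = 0" if "A \<in> sets M" for A
      using that by blast
    have one: "(\<lambda>w. 1) \<in> L"
      by (rule bounded_in_L[of _ 1]) simp_all
    have "z = (integral\<^sup>L M (rep z) / measure M (space M)) *\<^sub>C T (\<lambda>w. 1)" for z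
    proof -
      \<comment> \<open>If \<open>space M\<close> is null, division by zero gives
        \<open>c = 0\<close>, and every measurable set is null, so the integrals vanish all the
        same.\<close>
      define c where "c = integral\<^sup>L M (rep z) / measure M (space M)"
      define f where "f w = rep z w + (- c) * 1" for w
      have f: "f \<in> L"
        unfolding f_def by (intro L_add L_scale one rep)
      have "(LINT w:A|M. f w) = 0" if A: "A \<in> sets M" for A
      proof (cases "measure M A = 0")
        case False
        then have A': "measure M (space M - A) = 0"
          using triv[OF A] by blast
        then have "(LINT w:A|M. f w) = (LINT w|M. f w)"
          using set_integral_split[OF f A] set_integral_null[of "space M - A" f] A by auto
        also have "\<dots> = integral\<^sup>L M (rep z) + measure M (space M) *\<^sub>R (- c)"
          unfolding f_def using integrable_L[OF rep(1)] by simp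
        also have "\<dots> = 0"
        proof -
          have "measure M (space M) \<noteq> 0"
            using False A' finite_measure_compl[OF A] by simp
          then show ?thesis
            by (simp add: c_def scaleR_conv_of_real)
        qed
        finally show ?thesis .
      qed (use set_integral_null A in auto)
      then have "T f = 0"
        by (rule eq_zero_if_set_integrals_eq_0[OF f])
      moreover have "T f = z + (- c) *\<^sub>C T (\<lambda>w. 1)"
        unfolding f_def using T_add[OF rep(1)[of z] L_scale[OF one, of "- c"]] T_scale[OF one, of "- c"] rep(2) by simp
      moreover have "(- c) *\<^sub>C T (\<lambda>w. 1) + c *\<^sub>C T (\<lambda>w. 1) = 0"
        using scaleC_of_real[of 0 "T (\<lambda>w. 1)"] by (simp flip: scaleC_add_left)
      ultimately show ?thesis
        unfolding c_def[symmetric] by (metis add.commute add_left_cancel)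
    qed
    then show False
      using assms by blast
  qed
  then show ?thesis
    using that by (metis measure_nonneg order_le_less)
qed

text \<open>All set integrals of a representative of \<open>D (\<psi> 0)\<close> vanish, so
  \<open>D (\<psi> 0) = 0\<close>. Differentiating \<open>\<psi> (\<phi> x) = x\<close> at
  \<open>\<psi> 0\<close> gives \<open>D\<close> a left inverse \<open>E\<close>, hence
  \<open>\<psi> 0 = 0\<close>.\<close>

lemma automorphism_fixes_0:
  fixes \<phi> :: "'e \<Rightarrow> 'e"
  assumes "p \<noteq> 2" and dim: "\<nexists>u::'e. \<forall>v. \<exists>c. v = c *\<^sub>C u" and \<phi>: "\<phi> \<in> Aut_ball"
  shows "\<phi> 0 = 0"
proof -
  define \<psi> where "\<psi> = inv_into (ball 0 1) \<phi>"
  note aut = Aut_ballD[OF \<phi>, folded \<psi>_def]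
  have \<psi>0: "\<psi> 0 \<in> ball 0 1"
    using aut(4) by (rule subsetD) simp
  obtain D where D: "(\<phi> has_derivative D) (at (\<psi> 0))" "\<And>c v. D (c *\<^sub>C v) = c *\<^sub>C D v"
    using complex_frechet_holomorphic_onD[OF aut(1) \<psi>0] by blast
  define f where "f = rep (D (\<psi> 0))"
  have f: "f \<in> L" "T f = D (\<psi> 0)"
    by (simp_all add: f_def rep)
  have zero: "(LINT w:A|M. f w) = 0"
    if A: "A \<in> sets M" "0 < measure M A" "0 < measure M (space M - A)" for A
  proof -
    interpret lp_pair "T (bump A)" "T (bump (space M - A))" "mean_functional A" "mean_functional (space M - A)" p
      using A by (intro lp_pair_bump) auto
    interpret lp_pair_automorphism "T (bump A)" "T (bump (space M - A))" "mean_functional A"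
      "mean_functional (space M - A)" p \<phi> \<psi>
      by unfold_locales (rule aut; assumption)+
    have "mean_functional A (D (\<psi> 0)) = 0"
      by (rule functional_of_generator[OF \<open>p \<noteq> 2\<close> D])
    then show ?thesis
      using A by (simp add: mean_functional_def f_def)
  qed
  obtain B where B: "B \<in> sets M" "0 < measure M B" "0 < measure M (space M - B)"
    using nontrivial_set[OF dim] by blast
  have "space M - (space M - B) = B"
    using sets.sets_into_space[OF B(1)] by blast
  \<comment> \<open>Both \<open>B\<close> and its complement carry a pair. The vanishing total
    covers sets with null complement, which carry none.\<close>
  then have total: "(LINT w|M. f w) = 0"
    using set_integral_split[OF f(1) B(1)] zero[OF B] zero[of "space M - B"] B by simp
  have "(LINT w:A|M. f w) = 0" if A: "A \<in> sets M" for A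
  proof -
    consider "measure M A = 0" | "measure M (space M - A) = 0" | "0 < measure M A" "0 < measure M (space M - A)"
      by (metis measure_nonneg order_le_less)
    then show ?thesis
    proof cases
      case 1
      then show ?thesis by (rule set_integral_null[OF A])
    next
      case 2
      have "(LINT w:space M - A|M. f w) = 0"
        using A by (intro set_integral_null 2) auto
      then show ?thesis
        using set_integral_split[OF f(1) A] total by simp
    next
      case 3
      then show ?thesis by (rule zero[OF A])
    qed
  qed
  then have "D (\<psi> 0) = 0"
    using eq_zero_if_set_integrals_eq_0[OF f(1)] f(2) by simp
  moreover have "\<psi> 0 = 0"
  proof -
    have \<phi>\<psi>: "\<phi> (\<psi> 0) = 0"
      by (rule aut(5)) simp
    obtain E where E: "(\<psi> has_derivative E) (at 0)"
      using complex_frechet_holomorphic_onD[OF aut(3), of 0] by auto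
    have "((\<lambda>x. \<psi> (\<phi> x)) has_derivative (\<lambda>h. E (D h))) (at (\<psi> 0))"
      using has_derivative_compose[OF D(1), of \<psi> E] E \<phi>\<psi> by simp
    moreover have "((\<lambda>x. \<psi> (\<phi> x)) has_derivative (\<lambda>h. h)) (at (\<psi> 0))"
      by (rule has_derivative_transform_within_open[OF has_derivative_ident open_ball \<psi>0]) (simp add: aut(6))
    ultimately have "(\<lambda>h. E (D h)) = (\<lambda>h. h)"
      by (rule has_derivative_unique)
    then have "\<psi> 0 = E (D (\<psi> 0))"
      by metis
    also have "\<dots> = 0"
      using \<open>D (\<psi> 0) = 0\<close> linear_0[OF has_derivative_linear[OF E]] by simp
    finally show ?thesis .
  qed
  ultimately show ?thesis
    using aut(5)[of 0] by simp
qed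

end

subsection \<open>The two Bloch spaces\<close>

lemma holomorphic_on_imp_complex_frechet_holomorphic_on:
  assumes "f holomorphic_on S" "open S"
  shows "complex_frechet_holomorphic_on f S"
  unfolding complex_frechet_holomorphic_on_def
proof
  fix x assume "x \<in> S"
  then have "(f has_derivative (*) (deriv f x)) (at x)"
    using holomorphic_derivI[OF assms] by (simp add: has_field_derivative_def)
  then show "\<exists>D. (f has_derivative D) (at x) \<and> (\<forall>c v. D (c *\<^sub>C v) = c *\<^sub>C D v)"
    by (intro exI[of _ "(*) (deriv f x)"]) (simp add: scaleC_complex_def mult.left_commute)
qed

text \<open>Cauchy's inequality for the scalar function \<open>\<zeta> \<mapsto> l (\<phi> (\<zeta> h))\<close>.\<close>

lemma functional_derivative_bound:
  fixes \<phi> :: "'a::complex_banach \<Rightarrow> 'a" and l :: "'a \<Rightarrow> complex"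
  assumes \<phi>: "complex_frechet_holomorphic_on \<phi> (ball 0 1)" "\<phi> ` ball 0 1 \<subseteq> ball 0 1"
    and D: "(\<phi> has_derivative D) (at 0)" "\<And>c v. D (c *\<^sub>C v) = c *\<^sub>C D v"
    and l: "bounded_linear l" "\<And>c v. l (c *\<^sub>C v) = c * l v"
  shows "cmod (l (D h)) \<le> onorm l * norm h"
proof (rule tendsto_lowerbound)
  show "((\<lambda>t. onorm l * t) \<longlongrightarrow> onorm l * norm h) (at_right (norm h))"
    by (intro tendsto_intros)
  \<comment> \<open>With \<open>t\<close> above \<open>norm h\<close> the disc of radius
    \<open>1 / t\<close> in direction \<open>h\<close> stays in the open ball, also for
    \<open>h = 0\<close>.\<close>
  have "\<forall>\<^sub>F t in at_right (norm h). norm h < t"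
    by (simp add: eventually_at_filter)
  then show "\<forall>\<^sub>F t in at_right (norm h). cmod (l (D h)) \<le> onorm l * t"
  proof eventually_elim
    case (elim t)
    then have t: "0 < t"
      using norm_ge_zero[of h] by linarith
    define g where "g z = l (\<phi> (0 + z *\<^sub>C h))" for z
    have in_ball: "0 + z *\<^sub>C h \<in> ball 0 1" if "z \<in> cball 0 (1 / t)" for z
    proof -
      have "cmod z * norm h \<le> 1 / t * norm h"
        using that by (intro mult_right_mono) auto
      also have "\<dots> < 1"
        using elim t by simp
      finally show ?thesis
        by (simp add: norm_scaleC)
    qed
    have "complex_frechet_holomorphic_on (\<lambda>z. 0 + z *\<^sub>C h) (cball 0 (1 / t))"
      using complex_frechet_holomorphic_on_line[of 0 1 h] by simp
    then have "complex_frechet_holomorphic_on (\<lambda>z. \<phi> (0 + z *\<^sub>C h)) (cball 0 (1 / t))"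
      using in_ball by (intro complex_frechet_holomorphic_on_compose[OF _ \<phi>(1)]) auto
    moreover have "complex_frechet_holomorphic_on l UNIV"
      using complex_frechet_holomorphic_on_affine[OF l(1), of 0] l(2) by (simp add: scaleC_complex_def)
    ultimately have "complex_frechet_holomorphic_on g (cball 0 (1 / t))"
      unfolding g_def by (rule complex_frechet_holomorphic_on_compose) simp
    then have g: "g holomorphic_on cball 0 (1 / t)"
      by (rule complex_frechet_holomorphic_on_imp_holomorphic_on)
    have "cmod ((deriv ^^ 1) g 0) \<le> fact 1 * onorm l / (1 / t) ^ 1"
    proof (rule Cauchy_inequality)
      show "g holomorphic_on ball 0 (1 / t)"
        using g by (rule holomorphic_on_subset) auto
      show "continuous_on (cball 0 (1 / t)) g"
        using g by (rule holomorphic_on_imp_continuous_on)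
      fix z assume "cmod (0 - z) = 1 / t"
      then have "z \<in> cball 0 (1 / t)"
        by simp
      then have "\<phi> (0 + z *\<^sub>C h) \<in> ball 0 1"
        using \<phi>(2) in_ball by blast
      then have "onorm l * norm (\<phi> (0 + z *\<^sub>C h)) \<le> onorm l * 1"
        using onorm_pos_le[OF l(1)] by (intro mult_left_mono) auto
      then show "cmod (g z) \<le> onorm l"
        using onorm[OF l(1), of "\<phi> (0 + z *\<^sub>C h)"] unfolding g_def by linarith
    qed (use t in simp)
    moreover have "deriv g 0 = l (D h)"
    proof (rule DERIV_imp_deriv)
      have zero: "(0::complex) *\<^sub>C h = 0"
        using scaleC_of_real[of 0 h] by simp
      have "((\<lambda>z. z *\<^sub>C h) has_derivative (\<lambda>z. z *\<^sub>C h)) (at 0)"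
        by (rule bounded_linear_imp_has_derivative[OF bounded_linear_scaleC_left])
      moreover have "(\<phi> has_derivative D) (at ((0::complex) *\<^sub>C h))"
        using D(1) zero by simp
      ultimately have "((\<lambda>z. \<phi> (z *\<^sub>C h)) has_derivative (\<lambda>z. D (z *\<^sub>C h))) (at 0)"
        by (rule has_derivative_compose)
      then have "((\<lambda>z. l (\<phi> (z *\<^sub>C h))) has_derivative (\<lambda>z. l (D (z *\<^sub>C h)))) (at 0)"
        by (rule bounded_linear.has_derivative[OF l(1)])
      moreover have "(\<lambda>z. l (D (z *\<^sub>C h))) = (*) (l (D h))"
        by (simp add: D(2) l(2) fun_eq_iff mult.commute)
      ultimately show "(g has_field_derivative l (D h)) (at 0)"
        by (simp add: has_field_derivative_def g_def [abs_def])
    qed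
    ultimately show ?case
      by simp
  qed
qed simp

text \<open>When all automorphisms fix the origin, every derivative in the supremum is
  \<open>F\<close> composed with some \<open>D\<close>, and
  \<open>functional_derivative_bound\<close> keeps its norm below that of \<open>F\<close>.\<close>

lemma Bloch_inv_eq_holomorphic:
  assumes "\<And>\<phi> :: 'a::complex_banach \<Rightarrow> 'a. \<phi> \<in> Aut_ball \<Longrightarrow> \<phi> 0 = 0"
  shows "(Bloch_inv :: ('a \<Rightarrow> complex) set) = {f. complex_frechet_holomorphic_on f (ball 0 1)}"
proof -
  have "inv_seminorm f < \<infinity>" if f: "complex_frechet_holomorphic_on f (ball 0 1)" for f :: "'a \<Rightarrow> complex"
  proof -
    obtain F where F: "(f has_derivative F) (at 0)" "\<And>c v. F (c *\<^sub>C v) = c *\<^sub>C F v"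
      using complex_frechet_holomorphic_onD[OF f, of 0] by auto
    have bF: "bounded_linear F"
      using F(1) by (rule has_derivative_bounded_linear)
    have "onorm (frechet_derivative (f \<circ> \<phi>) (at 0)) \<le> onorm F" if \<phi>: "\<phi> \<in> Aut_ball" for \<phi>
    proof -
      note aut = Aut_ballD[OF \<phi>]
      obtain D where D: "(\<phi> has_derivative D) (at 0)" "\<And>c v. D (c *\<^sub>C v) = c *\<^sub>C D v"
        using complex_frechet_holomorphic_onD[OF aut(1), of 0] by auto
      have "((\<lambda>x. f (\<phi> x)) has_derivative (\<lambda>h. F (D h))) (at 0)"
        using has_derivative_compose[OF D(1), of f F] F(1) assms[OF \<phi>] by simp
      then have "frechet_derivative (f \<circ> \<phi>) (at 0) = (\<lambda>h. F (D h))"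
        unfolding o_def by (rule frechet_derivative_at[symmetric])
      moreover have "onorm (\<lambda>h. F (D h)) \<le> onorm F"
      proof (rule onorm_bound)
        show "0 \<le> onorm F"
          using bF by (rule onorm_pos_le)
        show "cmod (F (D h)) \<le> onorm F * norm h" for h
          using aut(1,2) D bF F(2) by (intro functional_derivative_bound) (auto simp: scaleC_complex_def)
      qed
      ultimately show ?thesis by simp
    qed
    then have "inv_seminorm f \<le> ennreal (onorm F)"
      unfolding inv_seminorm_def by (intro SUP_least ennreal_leI)
    then show ?thesis
      by (rule le_less_trans) simp
  qed
  then show ?thesis
    by (auto simp: Bloch_inv_def)
qed

text \<open>At the point \<open>(1 - e) *\<^sub>R u\<close> the derivative is
  \<open>l / e\<^sup>2\<close>, of norm at least \<open>1 / e\<^sup>2\<close>, while the weight is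
  at least \<open>e\<close>. The product is at least \<open>1 / e\<close>, which is
  unbounded.\<close>

lemma (in lp_pair) resolvent_not_in_Bloch_nat:
  defines "f \<equiv> \<lambda>z. 1 / (1 - l z)"
  shows "complex_frechet_holomorphic_on f (ball 0 1)" "f \<notin> Bloch_nat"
proof -
  have l_less: "l z \<in> ball 0 1" if "z \<in> ball 0 1" for z
  proof -
    have "cmod (l z) powr p \<le> norm z powr p"
      using contraction[of z] powr_ge_zero[of "cmod (m z)" p] by linarith
    also have "\<dots> < 1"
      using that powr_less_1 by simp
    finally show ?thesis
      using powr_less_1 by simp
  qed
  have "complex_frechet_holomorphic_on (\<lambda>w::complex. 1 / (1 - w)) (ball 0 1)"
    by (intro holomorphic_on_imp_complex_frechet_holomorphic_on holomorphic_intros) auto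
  from complex_frechet_holomorphic_on_compose[OF functionals_holomorphic(1) this]
  show hol: "complex_frechet_holomorphic_on f (ball 0 1)"
    unfolding f_def using l_less by blast
  have lower: "1 / e \<le> (1 - (norm ((1 - e) *\<^sub>R u))\<^sup>2) * onorm (frechet_derivative f (at ((1 - e) *\<^sub>R u)))"
    if e: "0 < e" "e < 1" for e :: real
  proof -
    define z where "z = (1 - e) *\<^sub>R u"
    have lz: "l z = of_real (1 - e)"
      using linear dual by (simp add: z_def linear_simps scaleR_conv_of_real)
    define F where "F h = l h / of_real (e\<^sup>2)" for h
    have "(f has_derivative F) (at z)"
    proof -
      have "((\<lambda>w. 1 / (1 - w)) has_field_derivative 1 / of_real (e\<^sup>2)) (at (l z))"
        unfolding lz using e by (auto intro!: derivative_eq_intros simp: power2_eq_square)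
      then have "((\<lambda>w. 1 / (1 - w)) has_derivative (*) (1 / of_real (e\<^sup>2))) (at (l z))"
        by (simp add: has_field_derivative_def)
      from has_derivative_compose[OF bounded_linear_imp_has_derivative[OF linear(1)] this]
      show ?thesis
        by (simp add: f_def F_def [abs_def])
    qed
    then have F: "frechet_derivative f (at z) = F" "bounded_linear F"
      by (auto simp: frechet_derivative_at[symmetric] has_derivative_bounded_linear)
    have "1 / e\<^sup>2 \<le> onorm F"
      using onorm[OF F(2), of u] by (simp add: F_def dual norm_basis norm_divide norm_power)
    moreover have "e \<le> 1 - (norm z)\<^sup>2"
    proof -
      have "norm z = 1 - e"
        using e unfolding z_def norm_scaleR norm_basis by simp
      moreover have "(1 - e) * (1 - e) \<le> (1 - e) * 1"
        using e by (intro mult_left_mono) auto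
      ultimately show ?thesis
        by (simp add: power2_eq_square)
    qed
    ultimately have "e * (1 / e\<^sup>2) \<le> (1 - (norm z)\<^sup>2) * onorm F"
      using e by (intro mult_mono) auto
    then show ?thesis
      using e F(1) unfolding z_def[symmetric] by (simp add: power2_eq_square)
  qed
  have "nat_seminorm f = \<infinity>"
  proof (rule ccontr)
    assume "nat_seminorm f \<noteq> \<infinity>"
    then obtain C where C: "0 \<le> C" "nat_seminorm f = ennreal C"
      by (cases "nat_seminorm f") auto
    \<comment> \<open>Then \<open>1 / e = C + 2\<close> exceeds \<open>C\<close>, and
      \<open>e < 1\<close> holds even for \<open>C = 0\<close>.\<close>
    define e where "e = 1 / (C + 2)"
    have e: "0 < e" "e < 1"
      using C by (auto simp: e_def field_simps)
    have "(1 - e) *\<^sub>R u \<in> ball 0 1"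
      using e unfolding mem_ball_0 norm_scaleR norm_basis by simp
    then have "ennreal ((1 - (norm ((1 - e) *\<^sub>R u))\<^sup>2) * onorm (frechet_derivative f (at ((1 - e) *\<^sub>R u)))) \<le> ennreal C"
      unfolding C(2)[symmetric] nat_seminorm_def by (rule SUP_upper)
    then have "(1 - (norm ((1 - e) *\<^sub>R u))\<^sup>2) * onorm (frechet_derivative f (at ((1 - e) *\<^sub>R u))) \<le> C"
      using C(1) by (simp add: ennreal_le_iff)
    with lower[OF e] have "1 / e \<le> C"
      by linarith
    then show False
      using C(1) by (simp add: e_def)
  qed
  then show "f \<notin> Bloch_nat"
    by (simp add: Bloch_nat_def)
qed

text \<open>Since the invariant space contains all holomorphic functions, inclusion is immediate and
  the resolvent shows strictness. The assumption \<open>dim_ge_2\<close> excludes spaces spanned by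
  one vector, where the ball is a point or a disc and the two spaces coincide.\<close>

theorem proposition2p7:
  fixes M :: "'w measure"
    and p :: real
    and T :: "('w \<Rightarrow> complex) \<Rightarrow> 'e::complex_banach"
  assumes "finite_measure M"
    and "1 \<le> p" and "p \<noteq> 2"
    and "is_Lp_space M p T"
    and dim_ge_2: "\<nexists>u::'e. \<forall>v. \<exists>c. v = c *\<^sub>C u"
  shows "(Bloch_nat :: ('e \<Rightarrow> complex) set) \<subset> Bloch_inv"
proof -
  interpret finite_measure M by fact
  interpret Lp_space M p T
    by unfold_locales fact+
  have inv: "(Bloch_inv :: ('e \<Rightarrow> complex) set) = {f. complex_frechet_holomorphic_on f (ball 0 1)}"
    using automorphism_fixes_0[OF \<open>p \<noteq> 2\<close> dim_ge_2] by (rule Bloch_inv_eq_holomorphic)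
  obtain A where A: "A \<in> sets M" "0 < measure M A" "0 < measure M (space M - A)"
    using nontrivial_set[OF dim_ge_2] by blast
  interpret lp_pair "T (bump A)" "T (bump (space M - A))" "mean_functional A" "mean_functional (space M - A)" p
    using A by (intro lp_pair_bump) auto
  show ?thesis
    using resolvent_not_in_Bloch_nat unfolding inv by (auto simp: Bloch_nat_def)
qed

end
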